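(* Let $n\ge1$ and let $(X_0,X_1,\dotsc,X_n)$ be a discrete-time martingale with respect to $(E_1,\dots,E_n)$ such that $X_i\in[0,1]$ for all $i\in\{1,\dotsc,n\}$ and $X_n\in\{0,1\}$. Then $$\sup_{\tau}\ \mathbb{E}\big[\,|X_\tau-X_{\tau-1}|\cdot\mathbf{1}_{\{\tau<\infty\}}\big]\ \geq\ C'_n(X_0),$$ where the supremum is over all specialized stopping times $\tau$.
   Context: The transform $T$ on curves $Y=f(X)$ ($f:[0,1]\to\mathbb{R}_{\ge0}$): $T$ of it is $Y=g(X)$, where $x_S(x)\in[0,1]$ solves $X+f(X)=x$, $x_L(x)\in[0,1]$ solves $X-f(X)=x$, and $g(x)=2ab/(a+b)$ with $a=f(x_S(x))$, $b=f(x_L(x))$ (taken to be $0$ if $a$ or $b$ is $0$). Define $C'_1(X)=X(1-X)$ and $C'_k=T^{k-1}(C'_1)$. Specialized stopping times: a random variable $\tau$ with values in $\{1,\dots,n,\infty\}$ (where $\{\tau\le k\}$ is determined by $E_1,\dots,E_k$) is specialized if it is obtained recursively as follows. For $0\le i\le n-1$ and every prefix $e_1,\dots,e_i$ on which $\tau>i$, let $x=X_i(e_1,\dots,e_i)$. If $i<n-1$, let $x_0\in[0,1]$ be the solution of $x-x_0=C'_{n-i-1}(x_0)$ and $x_1\in[0,1]$ the solution of $x_1-x=C'_{n-i-1}(x_1)$; then either (a) $\tau=i+1$ exactly when $X_{i+1}\le x_0$ (and $\tau>i+1$ otherwise), or (b) $\tau=i+1$ exactly when $X_{i+1}\ge x_1$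 (and $\tau>i+1$ otherwise); the choice between (a) and (b) may depend on the prefix. If $i=n-1$, then either $\tau=n$ exactly when $X_n=0$, or $\tau=n$ exactly when $X_n=1$, and $\tau=\infty$ otherwise. *)

theory Defs
  imports "HOL-Probability.Probability"
begin

text \<open>
  A curve \<open>Y = f(X)\<close>, \<open>X \<in> [0,1]\<close>, is a function on all reals of which only the values on
  \<open>[0,1]\<close> are relevant.
\<close>

definition left_sol :: "(real \<Rightarrow> real) \<Rightarrow> real \<Rightarrow> real" where
  "left_sol f x = (THE X. X \<in> {0..1} \<and> X + f X = x)"

definition right_sol :: "(real \<Rightarrow> real) \<Rightarrow> real \<Rightarrow> real" where
  "right_sol f x = (THE X. X \<in> {0..1} \<and> X - f X = x)"

definition curve_transform :: "(real \<Rightarrow> real) \<Rightarrow> real \<Rightarrow> real" where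
  "curve_transform f x =
     (let a = f (left_sol f x); b = f (right_sol f x)
      in if a = 0 \<or> b = 0 then 0 else 2 * a * b / (a + b))"

text \<open>Only the indices \<open>k \<ge> 1\<close> are meaningful.\<close>

definition C' :: "nat \<Rightarrow> real \<Rightarrow> real" where
  "C' k = (curve_transform ^^ (k - 1)) (\<lambda>X. X * (1 - X))"

text \<open>The \<open>\<sigma>\<close>-algebra generated by \<open>E 1, \<dots>, E i\<close>; for \<open>i = 0\<close> it is the trivial one.\<close>

definition gen_sigma ::
  "'a measure \<Rightarrow> (nat \<Rightarrow> 'b measure) \<Rightarrow> (nat \<Rightarrow> 'a \<Rightarrow> 'b) \<Rightarrow> nat \<Rightarrow> 'a measure" where
  "gen_sigma M N E i =
     vimage_algebra (space M) (\<lambda>\<omega>. \<lambda>j\<in>{1..i}. E j \<omega>) (Pi\<^sub>M {1..i} N)"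

definition martingale_wrt ::
  "'a measure \<Rightarrow> (nat \<Rightarrow> 'b measure) \<Rightarrow> (nat \<Rightarrow> 'a \<Rightarrow> 'b) \<Rightarrow> nat \<Rightarrow> (nat \<Rightarrow> 'a \<Rightarrow> real) \<Rightarrow> bool"
  where
  "martingale_wrt M N E n X \<longleftrightarrow>
     (\<forall>i\<in>{1..n}. E i \<in> measurable M (N i)) \<and>
     (\<forall>i\<le>n. X i \<in> borel_measurable (gen_sigma M N E i) \<and> integrable M (X i)) \<and>
     (\<forall>i<n. AE \<omega> in M. real_cond_exp M (gen_sigma M N E i) (X (Suc i)) \<omega> = X i \<omega>)"

text \<open>
  The prefix \<open>e\<^sub>1, \<dots>, e\<^sub>i\<close> realised at an outcome \<open>\<omega>\<close> is represented by the set of all outcomes with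
  the same prefix.  The functions \<open>X i\<close> and the events \<open>\<tau> \<le> i\<close> are constant on this set, because
  they are measurable with respect to \<open>gen_sigma M N E i\<close>.
\<close>

definition same_prefix :: "'a measure \<Rightarrow> (nat \<Rightarrow> 'a \<Rightarrow> 'b) \<Rightarrow> nat \<Rightarrow> 'a \<Rightarrow> 'a set" where
  "same_prefix M E i \<omega> = {\<omega>' \<in> space M. \<forall>j\<in>{1..i}. E j \<omega>' = E j \<omega>}"

text \<open>
  In the recursive condition, \<open>left_sol (C' (n - i - 1)) x\<close> is the solution \<open>x\<^sub>0\<close> of
  \<open>x - x\<^sub>0 = C' (n - i - 1) x\<^sub>0\<close>, and \<open>right_sol (C' (n - i - 1)) x\<close> is the solution \<open>x\<^sub>1\<close> of
  \<open>x\<^sub>1 - x = C' (n - i - 1) x\<^sub>1\<close>.  Since the disjunction is inside the quantifier over \<open>\<omega>\<close>, its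
  choice may depend on the prefix.
\<close>

definition specialized ::
  "'a measure \<Rightarrow> (nat \<Rightarrow> 'b measure) \<Rightarrow> (nat \<Rightarrow> 'a \<Rightarrow> 'b) \<Rightarrow> nat \<Rightarrow> (nat \<Rightarrow> 'a \<Rightarrow> real)
    \<Rightarrow> ('a \<Rightarrow> enat) \<Rightarrow> bool" where
  "specialized M N E n X \<tau> \<longleftrightarrow>
     (\<forall>\<omega>\<in>space M. \<tau> \<omega> \<in> insert \<infinity> (enat ` {1..n})) \<and>
     (\<forall>k\<in>{1..n}. {\<omega>\<in>space M. \<tau> \<omega> \<le> enat k} \<in> sets (gen_sigma M N E k)) \<and>
     (\<forall>i<n. \<forall>\<omega>\<in>space M. enat i < \<tau> \<omega> \<longrightarrow>
        (if i < n - 1 then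
           (let x = X i \<omega>;
                x\<^sub>0 = left_sol (C' (n - i - 1)) x;
                x\<^sub>1 = right_sol (C' (n - i - 1)) x
            in (\<forall>\<omega>'\<in>same_prefix M E i \<omega>. \<tau> \<omega>' = enat (i + 1) \<longleftrightarrow> X (i + 1) \<omega>' \<le> x\<^sub>0) \<or>
               (\<forall>\<omega>'\<in>same_prefix M E i \<omega>. \<tau> \<omega>' = enat (i + 1) \<longleftrightarrow> X (i + 1) \<omega>' \<ge> x\<^sub>1))
         else
           (\<forall>\<omega>'\<in>same_prefix M E i \<omega>. \<tau> \<omega>' = enat n \<longleftrightarrow> X n \<omega>' = 0) \<or>
           (\<forall>\<omega>'\<in>same_prefix M E i \<omega>. \<tau> \<omega>' = enat n \<longleftrightarrow> X n \<omega>' = 1)))"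

definition jump_at :: "(nat \<Rightarrow> 'a \<Rightarrow> real) \<Rightarrow> ('a \<Rightarrow> enat) \<Rightarrow> 'a \<Rightarrow> real" where
  "jump_at X \<tau> \<omega> =
     (case \<tau> \<omega> of enat k \<Rightarrow> \<bar>X k \<omega> - X (k - 1) \<omega>\<bar> | \<infinity> \<Rightarrow> 0)"

end

theory Submission
  imports Defs
begin

text \<open>
  All curves \<open>C' k\<close> are concave and lie between \<open>0\<close> and \<open>x (1 - x)\<close>; such curves are strictly
  1-Lipschitz, and \<open>T\<close> preserves the class.  Let \<open>f = C' (k - 1)\<close>, let \<open>a\<close> and \<open>b\<close> be its values at the
  two solutions for \<open>x\<close>, and let \<open>y\<close> be the next value of the martingale.  Rules (a) and (b), followed by
  \<open>f\<close> if the process goes on, give two gains as functions of \<open>y\<close>.  Their mixture with weights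
  \<open>a / (a + b)\<close> and \<open>b / (a + b)\<close> lies above the chord of \<open>f\<close> through the two solutions, which is affine
  with value \<open>2ab / (a + b) = T f x\<close> at \<open>x\<close>.  So the mixture has conditional expectation at least
  \<open>T f x\<close>, and so does the better of the two rules.  Backward induction on time, with
  inequalities integrated over arbitrary events of the current \<open>\<sigma>\<close>-algebra, gives the bound for the
  time of the first stop under the better rules.
\<close>

subsection \<open>Concave curves below the parabola\<close>

definition admissible_curve :: "(real \<Rightarrow> real) \<Rightarrow> bool" where
  "admissible_curve f \<longleftrightarrow> concave_on {0..1} f \<and> (\<forall>x\<in>{0..1}. 0 \<le> f x \<and> f x \<le> x * (1 - x))"

lemma admissible_curve_nonneg: "admissible_curve f \<Longrightarrow> x \<in> {0..1} \<Longrightarrow> 0 \<le> f x"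
  by (simp add: admissible_curve_def)

lemma admissible_curve_le: "admissible_curve f \<Longrightarrow> x \<in> {0..1} \<Longrightarrow> f x \<le> x * (1 - x)"
  by (simp add: admissible_curve_def)

lemma admissible_curve_concave:
  assumes "admissible_curve f" "x \<in> {0..1}" "y \<in> {0..1}" "0 \<le> u" "0 \<le> v" "u + v = 1"
  shows "u * f x + v * f y \<le> f (u * x + v * y)"
  using assms unfolding admissible_curve_def concave_on_iff by auto

lemma admissible_curve_endpoints:
  assumes "admissible_curve f"
  shows "f 0 = 0" "f 1 = 0"
  using admissible_curve_nonneg[OF assms, of 0] admissible_curve_le[OF assms, of 0]
    admissible_curve_nonneg[OF assms, of 1] admissible_curve_le[OF assms, of 1] by auto

text \<open>Concavity puts the graph above the chords joining it to the zeros at \<open>0\<close>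
  and \<open>1\<close>. With \<open>f x \<le> x * (1 - x)\<close> this bounds the slope of the
  secant by \<open>1 - v\<close> from above and by \<open>- u\<close> from below, strictly inside
  the unit range because \<open>0 < v\<close> and \<open>u < 1\<close>.\<close>

lemma admissible_curve_slope_less:
  assumes f: "admissible_curve f" and uv: "0 \<le> u" "u < v" "v \<le> 1"
  shows "f v - f u < v - u" "f u - f v < v - u"
proof -
  have "(1 - u / v) * f 0 + (u / v) * f v \<le> f ((1 - u / v) * 0 + (u / v) * v)"
    by (rule admissible_curve_concave[OF f]) (use uv in auto)
  then have "(u / v) * f v \<le> f u"
    using uv admissible_curve_endpoints[OF f] by simp
  then have "v * (f v - f u) \<le> (v - u) * f v"
    using uv by (simp add: field_simps)
  also have "\<dots> \<le> (v - u) * (v * (1 - v))"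
    by (rule mult_left_mono[OF admissible_curve_le[OF f]]) (use uv in auto)
  finally have "v * (f v - f u) \<le> v * ((v - u) * (1 - v))"
    by (simp add: ac_simps)
  then have "f v - f u \<le> (v - u) * (1 - v)" using uv by simp
  also have "\<dots> < (v - u) * 1" by (rule mult_strict_left_mono) (use uv in auto)
  finally show "f v - f u < v - u" by simp
next
  define t where "t = (1 - v) / (1 - u)"
  have t: "0 \<le> t" "t \<le> 1" "t * (1 - u) = 1 - v" using uv by (auto simp: t_def)
  have "t * f u + (1 - t) * f 1 \<le> f (t * u + (1 - t) * 1)"
    by (rule admissible_curve_concave[OF f]) (use uv t in auto)
  moreover have "t * u + (1 - t) * 1 = v" using t(3) by (simp add: algebra_simps)
  ultimately have "t * f u \<le> f v"
    using admissible_curve_endpoints[OF f] by simp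
  then have "(t * (1 - u)) * f u \<le> (1 - u) * f v"
    using mult_left_mono[of "t * f u" "f v" "1 - u"] uv by (simp add: ac_simps)
  then have "(1 - u) * (f u - f v) \<le> (v - u) * f u"
    unfolding t(3) by (simp add: algebra_simps)
  also have "\<dots> \<le> (v - u) * (u * (1 - u))"
    by (rule mult_left_mono[OF admissible_curve_le[OF f]]) (use uv in auto)
  finally have "(1 - u) * (f u - f v) \<le> (1 - u) * ((v - u) * u)"
    by (simp add: ac_simps)
  then have "f u - f v \<le> (v - u) * u" using uv by simp
  also have "\<dots> < (v - u) * 1" by (rule mult_strict_left_mono) (use uv in auto)
  finally show "f u - f v < v - u" by simp
qed

text \<open>The strict slope bound makes \<open>x + f x\<close> strictly increasing although
  \<open>f\<close> may decrease. Uniqueness, monotonicity and comparison for \<open>left_sol\<close>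
  all rest on this.\<close>

lemma admissible_curve_plus_le_iff:
  assumes f: "admissible_curve f" and "x \<in> {0..1}" "y \<in> {0..1}"
  shows "x + f x \<le> y + f y \<longleftrightarrow> x \<le> y"
  using admissible_curve_slope_less[OF f, of x y] admissible_curve_slope_less[OF f, of y x] assms
  by (cases x y rule: linorder_cases) auto

lemma admissible_curve_minus_le_iff:
  assumes f: "admissible_curve f" and "x \<in> {0..1}" "y \<in> {0..1}"
  shows "x - f x \<le> y - f y \<longleftrightarrow> x \<le> y"
  using admissible_curve_slope_less[OF f, of x y] admissible_curve_slope_less[OF f, of y x] assms
  by (cases x y rule: linorder_cases) auto

lemma admissible_curve_continuous:
  assumes f: "admissible_curve f"
  shows "continuous_on {0..1} f"
proof -
  have "\<bar>f x - f y\<bar> \<le> \<bar>x - y\<bar>" if "x \<in> {0..1}" "y \<in> {0..1}" for x y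
    using admissible_curve_slope_less[OF f, of x y] admissible_curve_slope_less[OF f, of y x] that
    by (cases x y rule: linorder_cases) auto
  then have "1-lipschitz_on {0..1} f"
    by (intro lipschitz_onI) (auto simp: dist_real_def)
  then show ?thesis by (rule lipschitz_on_continuous_on)
qed

section \<open>The left and right solutions as functions of \<open>x\<close>\<close>

lemma left_sol:
  assumes f: "admissible_curve f" and x: "x \<in> {0..1}"
  shows "left_sol f x \<in> {0..1}" "left_sol f x + f (left_sol f x) = x"
proof -
  \<comment> \<open>\<open>X + f X\<close> runs continuously from \<open>0\<close> to
    \<open>1\<close> since \<open>f\<close> vanishes at both ends; strict monotonicity then makes
    the solution unique, so that the \<open>THE\<close> in \<open>left_sol\<close> denotes
    it.\<close>
  have "\<exists>X\<ge>0. X \<le> 1 \<and> X + f X = x"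
    by (rule IVT') (use x admissible_curve_endpoints[OF f] in
      \<open>auto intro!: continuous_intros admissible_curve_continuous[OF f]\<close>)
  moreover have "X = Y" if "X \<in> {0..1}" "Y \<in> {0..1}" "X + f X = x" "Y + f Y = x" for X Y
    using admissible_curve_plus_le_iff[OF f, of X Y] admissible_curve_plus_le_iff[OF f, of Y X] that
    by simp
  ultimately have "\<exists>!X. X \<in> {0..1} \<and> X + f X = x" by (metis atLeastAtMost_iff)
  from theI'[OF this] show "left_sol f x \<in> {0..1}" "left_sol f x + f (left_sol f x) = x"
    by (auto simp: left_sol_def)
qed

lemma right_sol:
  assumes f: "admissible_curve f" and x: "x \<in> {0..1}"
  shows "right_sol f x \<in> {0..1}" "right_sol f x - f (right_sol f x) = x"
proof -
  have "\<exists>X\<ge>0. X \<le> 1 \<and> X - f X = x"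
    by (rule IVT') (use x admissible_curve_endpoints[OF f] in
      \<open>auto intro!: continuous_intros admissible_curve_continuous[OF f]\<close>)
  moreover have "X = Y" if "X \<in> {0..1}" "Y \<in> {0..1}" "X - f X = x" "Y - f Y = x" for X Y
    using admissible_curve_minus_le_iff[OF f, of X Y] admissible_curve_minus_le_iff[OF f, of Y X] that
    by simp
  ultimately have "\<exists>!X. X \<in> {0..1} \<and> X - f X = x" by (metis atLeastAtMost_iff)
  from theI'[OF this] show "right_sol f x \<in> {0..1}" "right_sol f x - f (right_sol f x) = x"
    by (auto simp: right_sol_def)
qed

text \<open>Trades the implicitly defined solution for an explicit inequality in \<open>y\<close>;
  the convexity of \<open>left_sol\<close> is later read off from it.\<close>

lemma left_sol_le_iff:
  assumes "admissible_curve f" "x \<in> {0..1}" "y \<in> {0..1}"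
  shows "left_sol f x \<le> y \<longleftrightarrow> x \<le> y + f y"
  using admissible_curve_plus_le_iff[OF assms(1) left_sol(1)[OF assms(1,2)] assms(3)]
    left_sol(2)[OF assms(1,2)] by simp

lemma le_right_sol_iff:
  assumes "admissible_curve f" "x \<in> {0..1}" "y \<in> {0..1}"
  shows "y \<le> right_sol f x \<longleftrightarrow> y - f y \<le> x"
  using admissible_curve_minus_le_iff[OF assms(1,3) right_sol(1)[OF assms(1,2)]]
    right_sol(2)[OF assms(1,2)] by simp

text \<open>Monotonicity is what later makes the solution a Borel function of
  \<open>x\<close>.\<close>

lemma mono_on_left_sol:
  assumes f: "admissible_curve f"
  shows "mono_on {0..1} (left_sol f)"
proof (rule mono_onI)
  fix x y :: real assume "x \<in> {0..1}" "y \<in> {0..1}" "x \<le> y"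
  then show "left_sol f x \<le> left_sol f y"
    by (simp add: left_sol_le_iff[OF f _ left_sol(1)[OF f]] left_sol[OF f])
qed

lemma mono_on_right_sol:
  assumes f: "admissible_curve f"
  shows "mono_on {0..1} (right_sol f)"
proof (rule mono_onI)
  fix x y :: real assume "x \<in> {0..1}" "y \<in> {0..1}" "x \<le> y"
  then show "right_sol f x \<le> right_sol f y"
    by (simp add: le_right_sol_iff[OF f _ right_sol(1)[OF f]] right_sol[OF f])
qed

section \<open>The transform as a harmonic mean\<close>

lemma curve_transform_eq:
  assumes "admissible_curve f" "x \<in> {0..1}"
  defines "a \<equiv> f (left_sol f x)" and "b \<equiv> f (right_sol f x)"
  shows "curve_transform f x = 2 * a * b / (a + b)" "0 \<le> a" "0 \<le> b"
    "left_sol f x = x - a" "right_sol f x = x + b"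
    "f (x - a) = a" "f (x + b) = b"
proof -
  show "0 \<le> a" "0 \<le> b"
    unfolding a_def b_def using left_sol(1) right_sol(1) assms(1,2)
    by (blast intro: admissible_curve_nonneg)+
  \<comment> \<open>The case distinction in \<open>curve_transform\<close> is absorbed: if
    \<open>a\<close> or \<open>b\<close> is \<open>0\<close>, so is the numerator.\<close>
  then show "curve_transform f x = 2 * a * b / (a + b)"
    unfolding a_def b_def by (auto simp: curve_transform_def Let_def)
  show left: "left_sol f x = x - a" and right: "right_sol f x = x + b"
    using left_sol(2)[OF assms(1,2)] right_sol(2)[OF assms(1,2)] by (auto simp: a_def b_def)
  show "f (x - a) = a" "f (x + b) = b"
    unfolding left[symmetric] right[symmetric] by (simp_all add: a_def b_def)
qed

text \<open>The harmonic mean is the minimum over \<open>p\<close> of the right-hand side below, which exhibits it as a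
  minimum of monotone linear functions and hence as monotone and concave.\<close>

lemma harmonic_mean_le:
  fixes a b p :: real
  assumes "0 \<le> a" "0 \<le> b"
  shows "2 * a * b / (a + b) \<le> 2 * (p\<^sup>2 * a + (1 - p)\<^sup>2 * b)"
proof (cases "a + b = 0")
  case False
  then have pos: "0 < a + b" using assms by simp
  have "2 * a * b \<le> 2 * (p\<^sup>2 * a + (1 - p)\<^sup>2 * b) * (a + b)"
  proof -
    have "2 * (p\<^sup>2 * a + (1 - p)\<^sup>2 * b) * (a + b) - 2 * a * b = 2 * (p * a - (1 - p) * b)\<^sup>2"
      by (simp add: power2_eq_square algebra_simps)
    then show ?thesis by (smt (verit) zero_le_power2)
  qed
  then show ?thesis using pos by (simp add: pos_divide_le_eq)
qed (use assms in auto)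

text \<open>The minimum is attained at \<open>p = b / (a + b)\<close>, where
  \<open>p * a = (1 - p) * b\<close>. For \<open>a = b = 0\<close> both sides are
  \<open>0\<close>.\<close>

lemma harmonic_mean_eq:
  fixes a b :: real
  assumes "0 \<le> a" "0 \<le> b"
  shows "2 * a * b / (a + b) = 2 * ((b / (a + b))\<^sup>2 * a + (1 - b / (a + b))\<^sup>2 * b)"
proof (cases "a + b = 0")
  case False
  then have "1 - b / (a + b) = a / (a + b)" by (simp add: field_simps)
  moreover have "(b / (a + b))\<^sup>2 * a + (a / (a + b))\<^sup>2 * b = a * b * (a + b) / (a + b)\<^sup>2"
    by (simp add: power2_eq_square add_divide_distrib algebra_simps)
  ultimately show ?thesis using False by (simp add: power2_eq_square)
qed (use assms in \<open>auto simp: add_nonneg_eq_0_iff\<close>)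

text \<open>The solutions lie at distance \<open>a\<close> to the left and \<open>b\<close> to the
  right of \<open>x\<close>, with heights \<open>a\<close> and \<open>b\<close>, so their chord has
  height \<open>2 * a * b / (a + b)\<close> at \<open>x\<close>; concavity puts \<open>f\<close>
  above it. In this way the upper bound by the parabola passes to the transform.\<close>

lemma curve_transform_le:
  assumes f: "admissible_curve f" and x: "x \<in> {0..1}"
  shows "curve_transform f x \<le> f x"
proof -
  define a where "a = f (left_sol f x)"
  define b where "b = f (right_sol f x)"
  note ab = curve_transform_eq[OF f x, folded a_def b_def]
  show ?thesis
  proof (cases "a + b = 0")
    case True
    then show ?thesis using ab admissible_curve_nonneg[OF f x] by simp
  next
    case False
    have "b / (a + b) * f (left_sol f x) + a / (a + b) * f (right_sol f x)
        \<le> f (b / (a + b) * left_sol f x + a / (a + b) * right_sol f x)"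
      by (rule admissible_curve_concave[OF f left_sol(1)[OF f x] right_sol(1)[OF f x]])
        (use False ab in \<open>auto simp: add_divide_distrib[symmetric] add.commute\<close>)
    moreover have "b / (a + b) * left_sol f x + a / (a + b) * right_sol f x = x"
    proof -
      have "b / (a + b) * left_sol f x + a / (a + b) * right_sol f x
        = (b * (x - a) + a * (x + b)) / (a + b)" by (simp add: ab(4,5) add_divide_distrib)
      also have "\<dots> = x" using False by (simp add: field_simps)
      finally show ?thesis .
    qed
    ultimately show ?thesis
      using ab(1) by (simp add: a_def[symmetric] b_def[symmetric] add_divide_distrib[symmetric] ac_simps)
  qed
qed

lemma admissible_curve_transform:
  assumes f: "admissible_curve f"
  shows "admissible_curve (curve_transform f)"
  unfolding admissible_curve_def concave_on_iff
proof (intro conjI ballI allI impI)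
  fix x :: real assume x: "x \<in> {0..1}"
  show "0 \<le> curve_transform f x"
    using curve_transform_eq[OF f x] by simp
  show "curve_transform f x \<le> x * (1 - x)"
    using curve_transform_le[OF f x] admissible_curve_le[OF f x] by simp
next
  fix x y u v :: real
  assume xy: "x \<in> {0..1}" "y \<in> {0..1}" and uv: "0 \<le> u" "0 \<le> v" "u + v = 1"
  define z where "z = u * x + v * y"
  have z: "z \<in> {0..1}"
    unfolding z_def using convexD[OF convex_real_interval(5) xy uv] by simp
  define a where "a x = f (left_sol f x)" for x
  define b where "b x = f (right_sol f x)" for x
  note ab = curve_transform_eq[OF f, folded a_def b_def]
  \<comment> \<open>By concavity of \<open>f\<close>, \<open>X + f X\<close> is at least
    \<open>z\<close> at this convex combination, which therefore lies to the right of
    \<open>left_sol f z\<close>. Hence \<open>left_sol f\<close> is convex and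
    \<open>a x = x - left_sol f x\<close> is concave.\<close>
  have "u * left_sol f x + v * left_sol f y \<in> {0..1}"
    using convexD[OF convex_real_interval(5) left_sol(1)[OF f xy(1)] left_sol(1)[OF f xy(2)] uv] by simp
  then have "left_sol f z \<le> u * left_sol f x + v * left_sol f y"
    using admissible_curve_concave[OF f left_sol(1)[OF f xy(1)] left_sol(1)[OF f xy(2)] uv]
    by (simp add: left_sol_le_iff[OF f z] ab(4,6)[OF xy(1)] ab(4,6)[OF xy(2)])
      (simp add: z_def algebra_simps)
  then have a: "u * a x + v * a y \<le> a z"
    by (simp add: ab(4)[OF xy(1)] ab(4)[OF xy(2)] ab(4)[OF z]) (simp add: z_def algebra_simps)
  \<comment> \<open>Likewise \<open>right_sol f\<close> is concave, and with it
    \<open>b x = right_sol f x - x\<close>.\<close>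
  have "u * right_sol f x + v * right_sol f y \<in> {0..1}"
    using convexD[OF convex_real_interval(5) right_sol(1)[OF f xy(1)] right_sol(1)[OF f xy(2)] uv] by simp
  then have "u * right_sol f x + v * right_sol f y \<le> right_sol f z"
    using admissible_curve_concave[OF f right_sol(1)[OF f xy(1)] right_sol(1)[OF f xy(2)] uv]
    by (simp add: le_right_sol_iff[OF f z] ab(5,7)[OF xy(1)] ab(5,7)[OF xy(2)])
      (simp add: z_def algebra_simps)
  then have b: "u * b x + v * b y \<le> b z"
    by (simp add: ab(5)[OF xy(1)] ab(5)[OF xy(2)] ab(5)[OF z]) (simp add: z_def algebra_simps)
  \<comment> \<open>The minimiser at \<open>z\<close>: the linear bound for this fixed
    \<open>p\<close> is valid at \<open>x\<close> and \<open>y\<close> and exact at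
    \<open>z\<close>, so the concavity of \<open>a\<close> and \<open>b\<close> carries over to the
    harmonic mean.\<close>
  define p where "p = b z / (a z + b z)"
  have "u * curve_transform f x + v * curve_transform f y
      \<le> u * (2 * (p\<^sup>2 * a x + (1 - p)\<^sup>2 * b x)) + v * (2 * (p\<^sup>2 * a y + (1 - p)\<^sup>2 * b y))"
    using ab(1-3)[OF xy(1)] ab(1-3)[OF xy(2)] uv
    by (intro add_mono mult_left_mono) (auto simp only: intro!: harmonic_mean_le)
  also have "\<dots> = 2 * (p\<^sup>2 * (u * a x + v * a y) + (1 - p)\<^sup>2 * (u * b x + v * b y))"
    by (simp add: algebra_simps)
  also have "\<dots> \<le> 2 * (p\<^sup>2 * a z + (1 - p)\<^sup>2 * b z)"
    by (intro mult_left_mono add_mono a b) auto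
  also have "\<dots> = curve_transform f z"
    unfolding p_def by (simp only: ab(1)[OF z] harmonic_mean_eq[OF ab(2,3)[OF z]])
  finally show "u * curve_transform f x + v * curve_transform f y \<le> curve_transform f (u *\<^sub>R x + v *\<^sub>R y)"
    by (simp add: z_def)
qed auto

section \<open>The curves \<open>C' k\<close> and the one-step inequality\<close>

lemma C'_1: "C' 1 = (\<lambda>x. x * (1 - x))"
  by (simp add: C'_def)

text \<open>Truncated subtraction makes \<open>C' 0\<close> equal to \<open>C' 1\<close>, so the
  recursion starts at index \<open>1\<close>.\<close>

lemma C'_Suc: "1 \<le> k \<Longrightarrow> C' (Suc k) = curve_transform (C' k)"
  by (cases k) (auto simp: C'_def)

lemma admissible_curve_C':
  assumes "1 \<le> k"
  shows "admissible_curve (C' k)"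
  using assms
proof (induction k rule: dec_induct)
  case base
  have "u * (x * (1 - x)) + v * (y * (1 - y)) \<le> (u * x + v * y) * (1 - (u * x + v * y))"
    if "0 \<le> u" "0 \<le> v" "u + v = 1" for u v x y :: real
  proof -
    have v: "v = 1 - u" using that by simp
    have "(u * x + v * y) * (1 - (u * x + v * y)) - (u * (x * (1 - x)) + v * (y * (1 - y)))
        = u * v * (x - y)\<^sup>2"
      unfolding v by (simp add: power2_eq_square algebra_simps)
    then show ?thesis using that by (smt (verit) mult_nonneg_nonneg zero_le_power2)
  qed
  then show ?case
    unfolding C'_1 admissible_curve_def concave_on_iff by auto
next
  case (step k)
  then show ?case by (simp add: C'_Suc admissible_curve_transform)
qed

text \<open>The gain of rule (a) from the value \<open>x\<close> when the next value is
  \<open>y\<close>: the jump if the rule stops, and otherwise \<open>f y\<close>, the amount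
  credited to the later steps. \<open>payoff_high\<close> is its counterpart for rule (b).\<close>

definition payoff_low :: "(real \<Rightarrow> real) \<Rightarrow> real \<Rightarrow> real \<Rightarrow> real" where
  "payoff_low f x y = (if y \<le> left_sol f x then \<bar>y - x\<bar> else f y)"

definition payoff_high :: "(real \<Rightarrow> real) \<Rightarrow> real \<Rightarrow> real \<Rightarrow> real" where
  "payoff_high f x y = (if y \<ge> right_sol f x then \<bar>y - x\<bar> else f y)"

text \<open>The weight of rule (a) in the mixture. If both heights are \<open>0\<close>, division by
  zero yields weight \<open>0\<close>, that is, rule (b) alone.\<close>

definition mix_weight :: "(real \<Rightarrow> real) \<Rightarrow> real \<Rightarrow> real" where
  "mix_weight f x = f (left_sol f x) / (f (left_sol f x) + f (right_sol f x))"

text \<open>Rise \<open>b - a\<close> over run \<open>a + b\<close>, because the endpoints of the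
  chord are \<open>(x - a, a)\<close> and \<open>(x + b, b)\<close>.\<close>

definition chord_slope :: "(real \<Rightarrow> real) \<Rightarrow> real \<Rightarrow> real" where
  "chord_slope f x = (f (right_sol f x) - f (left_sol f x)) / (f (left_sol f x) + f (right_sol f x))"

text \<open>The right-hand side is the chord of \<open>f\<close> between the two solutions, whose value at \<open>x\<close> is
  \<open>curve_transform f x\<close>.  Between the solutions the bound is concavity; outside, the choice of weights
  reduces it to the Lipschitz bound.\<close>

lemma mixed_payoff_ge_chord:
  assumes f: "admissible_curve f" and x: "x \<in> {0..1}" and y: "y \<in> {0..1}"
  shows "curve_transform f x + chord_slope f x * (y - x)
    \<le> mix_weight f x * payoff_low f x y + (1 - mix_weight f x) * payoff_high f x y"
proof -
  define a where "a = f (left_sol f x)"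
  define b where "b = f (right_sol f x)"
  note ab = curve_transform_eq[OF f x, folded a_def b_def]
  note L = left_sol(1)[OF f x] and R = right_sol(1)[OF f x]
  have fy: "0 \<le> f y" by (rule admissible_curve_nonneg[OF f y])
  show ?thesis
  proof (cases "a + b = 0")
    \<comment> \<open>Here chord and weight degenerate to \<open>0\<close>, and only
      \<open>payoff_high f x y \<ge> 0\<close> is left to check.\<close>
    case True
    then show ?thesis
      using fy ab(1) by (simp add: mix_weight_def chord_slope_def a_def[symmetric] b_def[symmetric] payoff_high_def)
  next
    case False
    then have pos: "0 < a + b" using ab by simp
    have lip: "f u - f v \<le> \<bar>u - v\<bar>" if "u \<in> {0..1}" "v \<in> {0..1}" for u v
      using admissible_curve_slope_less[OF f, of u v] admissible_curve_slope_less[OF f, of v u] that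
      by (cases u v rule: linorder_cases) auto
    have "2 * a * b + (b - a) * (y - x) \<le> a * payoff_low f x y + b * payoff_high f x y"
    proof -
      consider "y \<le> x - a" | "x - a < y" "y < x + b" | "x + b \<le> y" by linarith
      then show ?thesis
      proof cases
        case 1
        \<comment> \<open>The stopping gain \<open>a * (x - y)\<close> cancels against the same term
          of the chord, leaving \<open>b * (2 * a - (x - y)) \<le> b * f y\<close>. This is the
          Lipschitz bound between \<open>y\<close> and the left solution, where \<open>f\<close> has
          value \<open>a\<close>. Case 3 is the mirror image.\<close>
        have "b * (a - (x - a - y)) \<le> b * f y"
          using lip[OF L y] 1 ab(3)
          by (intro mult_left_mono) (auto simp: ab(4,6))
        moreover have "payoff_low f x y = x - y" and "payoff_high f x y = f y"
          using 1 ab False by (auto simp: payoff_low_def payoff_high_def)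
        ultimately show ?thesis by (simp only:) (simp add: algebra_simps)
      next
        case 3
        have "a * (b - (y - x - b)) \<le> a * f y"
          using lip[OF R y] 3 ab(2)
          by (intro mult_left_mono) (auto simp: ab(5,7))
        moreover have "payoff_low f x y = f y" and "payoff_high f x y = y - x"
          using 3 ab False by (auto simp: payoff_low_def payoff_high_def)
        ultimately show ?thesis by (simp only:) (simp add: algebra_simps)
      next
        case 2
        define u where "u = (x + b - y) / (a + b)"
        have u: "0 \<le> u" "0 \<le> 1 - u" "u * (a + b) = x + b - y"
          using 2 pos by (auto simp: u_def)
        have "u * (x - a) + (1 - u) * (x + b) = y"
          using u(3) by (simp add: algebra_simps)
        then have "u * a + (1 - u) * b \<le> f y"
          using admissible_curve_concave[OF f L R u(1,2)] by (simp add: ab(4-7))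
        then have "(a + b) * (u * a + (1 - u) * b) \<le> (a + b) * f y"
          by (rule mult_left_mono) (use pos in auto)
        moreover have "(a + b) * (u * a + (1 - u) * b) = (u * (a + b)) * (a - b) + (a + b) * b"
          by (simp add: algebra_simps)
        moreover have "\<dots> = 2 * a * b + (b - a) * (y - x)"
          unfolding u(3) by (simp add: algebra_simps)
        moreover have "payoff_low f x y = f y" "payoff_high f x y = f y"
          using 2 ab by (auto simp: payoff_low_def payoff_high_def)
        ultimately show ?thesis by (simp add: algebra_simps)
      qed
    qed
    then have "(2 * a * b + (b - a) * (y - x)) / (a + b)
        \<le> (a * payoff_low f x y + b * payoff_high f x y) / (a + b)"
      using pos by (simp add: divide_right_mono)
    moreover have "1 - mix_weight f x = b / (a + b)"
      using False by (simp add: mix_weight_def a_def[symmetric] b_def[symmetric] field_simps)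
    ultimately show ?thesis
      by (simp add: ab(1) mix_weight_def chord_slope_def a_def[symmetric] b_def[symmetric] add_divide_distrib)
  qed
qed

section \<open>Bounds and Borel measurability of the one-step quantities\<close>

lemma mix_weight_bounds:
  assumes "admissible_curve f" "x \<in> {0..1}"
  shows "0 \<le> mix_weight f x" "mix_weight f x \<le> 1"
  using curve_transform_eq(2,3)[OF assms]
  unfolding mix_weight_def by (auto intro!: divide_le_eq_1[THEN iffD2])

lemma abs_chord_slope_le_1:
  assumes "admissible_curve f" "x \<in> {0..1}"
  shows "\<bar>chord_slope f x\<bar> \<le> 1"
  using curve_transform_eq(2,3)[OF assms]
  unfolding chord_slope_def abs_divide by (auto intro!: divide_le_eq_1[THEN iffD2])

lemma admissible_curve_le_1:
  assumes "admissible_curve f" "x \<in> {0..1}"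
  shows "f x \<le> 1"
  using admissible_curve_le[OF assms] assms(2) mult_le_one[of x "1 - x"] by auto

lemma payoff_bounds:
  assumes "admissible_curve f" "x \<in> {0..1}" "y \<in> {0..1}"
  shows "\<bar>payoff_low f x y\<bar> \<le> 1" "\<bar>payoff_high f x y\<bar> \<le> 1"
  using admissible_curve_nonneg[OF assms(1,3)] admissible_curve_le_1[OF assms(1,3)] assms
  by (auto simp: payoff_low_def payoff_high_def)

lemma borel_measurable_mono_on_unit:
  fixes g :: "real \<Rightarrow> real"
  assumes g: "mono_on {0..1} g" and [measurable]: "Y \<in> borel_measurable G"
    and Y: "\<And>\<omega>. \<omega> \<in> space G \<Longrightarrow> Y \<omega> \<in> {0..1}"
  shows "(\<lambda>\<omega>. g (Y \<omega>)) \<in> borel_measurable G"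
proof -
  \<comment> \<open>Monotonicity is known on the unit interval only; clamping the argument extends
    it to all reals without changing the values taken along \<open>Y\<close>.\<close>
  have "mono (\<lambda>x. g (max 0 (min 1 x)))"
    by (intro monoI mono_onD[OF g]) auto
  then have [measurable]: "(\<lambda>x. g (max 0 (min 1 x))) \<in> borel_measurable borel"
    by (rule borel_measurable_mono)
  have "(\<lambda>\<omega>. g (max 0 (min 1 (Y \<omega>)))) \<in> borel_measurable G"
    by measurable
  also have "?this \<longleftrightarrow> ?thesis"
    using Y by (intro measurable_cong arg_cong[of _ _ g]) fastforce
  finally show ?thesis .
qed

lemma
  assumes f: "admissible_curve f" and Y[measurable]: "Y \<in> borel_measurable G"
    and Y_range: "\<And>\<omega>. \<omega> \<in> space G \<Longrightarrow> Y \<omega> \<in> {0..1}"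
  shows borel_measurable_left_sol: "(\<lambda>\<omega>. left_sol f (Y \<omega>)) \<in> borel_measurable G"
    and borel_measurable_right_sol: "(\<lambda>\<omega>. right_sol f (Y \<omega>)) \<in> borel_measurable G"
    and borel_measurable_admissible_curve: "(\<lambda>\<omega>. f (Y \<omega>)) \<in> borel_measurable G"
proof -
  show "(\<lambda>\<omega>. left_sol f (Y \<omega>)) \<in> borel_measurable G"
    by (rule borel_measurable_mono_on_unit[OF mono_on_left_sol[OF f] Y Y_range])
  show "(\<lambda>\<omega>. right_sol f (Y \<omega>)) \<in> borel_measurable G"
    by (rule borel_measurable_mono_on_unit[OF mono_on_right_sol[OF f] Y Y_range])
  \<comment> \<open>\<open>f\<close> need not be monotone, but \<open>x + f x\<close> is, and
    subtracting the identity recovers \<open>f\<close>.\<close>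
  have "mono_on {0..1} (\<lambda>x. x + f x)"
    using admissible_curve_plus_le_iff[OF f] by (auto intro!: mono_onI)
  then have [measurable]: "(\<lambda>\<omega>. Y \<omega> + f (Y \<omega>)) \<in> borel_measurable G"
    by (rule borel_measurable_mono_on_unit[OF _ Y Y_range])
  have "(\<lambda>\<omega>. (Y \<omega> + f (Y \<omega>)) - Y \<omega>) \<in> borel_measurable G"
    by measurable
  then show "(\<lambda>\<omega>. f (Y \<omega>)) \<in> borel_measurable G" by simp
qed

lemma
  assumes f: "admissible_curve f"
    and Y[measurable]: "Y \<in> borel_measurable G" and Z[measurable]: "Z \<in> borel_measurable G"
    and Y_range: "\<And>\<omega>. \<omega> \<in> space G \<Longrightarrow> Y \<omega> \<in> {0..1}"
    and Z_range: "\<And>\<omega>. \<omega> \<in> space G \<Longrightarrow> Z \<omega> \<in> {0..1}"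
  shows borel_measurable_payoff_low: "(\<lambda>\<omega>. payoff_low f (Y \<omega>) (Z \<omega>)) \<in> borel_measurable G"
    and borel_measurable_payoff_high: "(\<lambda>\<omega>. payoff_high f (Y \<omega>) (Z \<omega>)) \<in> borel_measurable G"
proof -
  note [measurable] = borel_measurable_left_sol[OF f Y Y_range] borel_measurable_right_sol[OF f Y Y_range]
    borel_measurable_admissible_curve[OF f Z Z_range]
  show "(\<lambda>\<omega>. payoff_low f (Y \<omega>) (Z \<omega>)) \<in> borel_measurable G"
    unfolding payoff_low_def by measurable
  show "(\<lambda>\<omega>. payoff_high f (Y \<omega>) (Z \<omega>)) \<in> borel_measurable G"
    unfolding payoff_high_def by measurable
qed

lemma
  assumes f: "admissible_curve f" and Y[measurable]: "Y \<in> borel_measurable G"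
    and Y_range: "\<And>\<omega>. \<omega> \<in> space G \<Longrightarrow> Y \<omega> \<in> {0..1}"
  shows borel_measurable_mix_weight: "(\<lambda>\<omega>. mix_weight f (Y \<omega>)) \<in> borel_measurable G"
    and borel_measurable_chord_slope: "(\<lambda>\<omega>. chord_slope f (Y \<omega>)) \<in> borel_measurable G"
proof -
  have [measurable]: "(\<lambda>\<omega>. f (left_sol f (Y \<omega>))) \<in> borel_measurable G"
    "(\<lambda>\<omega>. f (right_sol f (Y \<omega>))) \<in> borel_measurable G"
    by (rule borel_measurable_admissible_curve[OF f borel_measurable_left_sol[OF f Y Y_range] left_sol(1)[OF f Y_range]]
        borel_measurable_admissible_curve[OF f borel_measurable_right_sol[OF f Y Y_range] right_sol(1)[OF f Y_range]];
        assumption)+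
  show "(\<lambda>\<omega>. mix_weight f (Y \<omega>)) \<in> borel_measurable G"
    unfolding mix_weight_def by measurable
  show "(\<lambda>\<omega>. chord_slope f (Y \<omega>)) \<in> borel_measurable G"
    unfolding chord_slope_def by measurable
qed

subsection \<open>Stopping at the first hit\<close>

text \<open>\<open>i\<close> is the current time and \<open>r\<close> the number of steps left.
  Recursion on \<open>r\<close> peels off the next step, as the backward induction over time
  requires.\<close>

primrec first_hit :: "(nat \<Rightarrow> 'a set) \<Rightarrow> nat \<Rightarrow> nat \<Rightarrow> 'a \<Rightarrow> enat" where
  "first_hit S i 0 \<omega> = \<infinity>"
| "first_hit S i (Suc r) \<omega> = (if \<omega> \<in> S (Suc i) then enat (Suc i) else first_hit S (Suc i) r \<omega>)"

lemma first_hit_eq_enat_iff: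
  "first_hit S i r \<omega> = enat k \<longleftrightarrow> i < k \<and> k \<le> i + r \<and> \<omega> \<in> S k \<and> (\<forall>j\<in>{i<..<k}. \<omega> \<notin> S j)"
proof (induction r arbitrary: i)
  case (Suc r)
  show ?case
  proof (cases "\<omega> \<in> S (Suc i)")
    case True
    then have "Suc i \<in> {i<..<k}" if "i < k" "k \<noteq> Suc i" using that by auto
    then show ?thesis using True by auto
  next
    case False
    then have "(\<forall>j\<in>{i<..<k}. \<omega> \<notin> S j) \<longleftrightarrow> (\<forall>j\<in>{Suc i<..<k}. \<omega> \<notin> S j)"
      by (metis Suc_lessI greaterThanLessThan_iff Suc_lessD)
    moreover have "k \<noteq> Suc i" if "\<omega> \<in> S k" using that False by auto
    ultimately show ?thesis using False by (auto simp: Suc.IH)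
  qed
qed auto

lemma first_hit_le_iff:
  assumes "i \<le> r"
  shows "first_hit S 0 r \<omega> \<le> enat i \<longleftrightarrow> (\<exists>j\<in>{1..i}. \<omega> \<in> S j)"
proof
  assume "first_hit S 0 r \<omega> \<le> enat i"
  then obtain j where "first_hit S 0 r \<omega> = enat j" "j \<le> i"
    by (metis enat_ile enat_ord_simps(1))
  then show "\<exists>j\<in>{1..i}. \<omega> \<in> S j"
    by (auto simp: first_hit_eq_enat_iff intro!: bexI[of _ j])
next
  assume "\<exists>j\<in>{1..i}. \<omega> \<in> S j"
  then have ex: "\<exists>j. 1 \<le> j \<and> j \<le> i \<and> \<omega> \<in> S j" by auto
  define j where "j = (LEAST j. 1 \<le> j \<and> j \<le> i \<and> \<omega> \<in> S j)"
  have j: "1 \<le> j" "j \<le> i" "\<omega> \<in> S j"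
    using LeastI_ex[OF ex] by (auto simp: j_def)
  have "\<omega> \<notin> S l" if "l \<in> {0<..<j}" for l
    using not_less_Least[of l "\<lambda>j. 1 \<le> j \<and> j \<le> i \<and> \<omega> \<in> S j", folded j_def] that j(2) by auto
  then have "first_hit S 0 r \<omega> = enat j"
    using j assms by (auto simp: first_hit_eq_enat_iff)
  then show "first_hit S 0 r \<omega> \<le> enat i" using j by simp
qed

lemma first_hit_range: "first_hit S 0 r \<omega> \<in> insert \<infinity> (enat ` {1..r})"
proof (cases "first_hit S 0 r \<omega>")
  case (enat k)
  then show ?thesis by (auto simp: first_hit_eq_enat_iff)
qed simp

lemma jump_at_first_hit_0: "jump_at X (first_hit S i 0) \<omega> = 0"
  by (simp add: jump_at_def)

lemma jump_at_first_hit_Suc: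
  "jump_at X (first_hit S i (Suc r)) \<omega> =
    (if \<omega> \<in> S (Suc i) then \<bar>X (Suc i) \<omega> - X i \<omega>\<bar> else jump_at X (first_hit S (Suc i) r) \<omega>)"
  by (simp add: jump_at_def)

declare first_hit.simps [simp del]

text \<open>Choosing the better of two gains according to the sign of the conditional expectation of their
  difference beats every mixture.\<close>

lemma (in finite_measure_subalgebra) exists_optimal_choice:
  fixes U V p :: "'a \<Rightarrow> real"
  assumes [measurable]: "U \<in> borel_measurable M" "V \<in> borel_measurable M" "p \<in> borel_measurable F"
    and U: "\<And>\<omega>. \<omega> \<in> space M \<Longrightarrow> \<bar>U \<omega>\<bar> \<le> 1"
    and V: "\<And>\<omega>. \<omega> \<in> space M \<Longrightarrow> \<bar>V \<omega>\<bar> \<le> 1"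
    and p: "\<And>\<omega>. \<omega> \<in> space M \<Longrightarrow> 0 \<le> p \<omega> \<and> p \<omega> \<le> 1"
  shows "\<exists>D\<in>sets F. \<forall>A\<in>sets F.
    (\<integral>\<omega>. indicator A \<omega> * (p \<omega> * U \<omega> + (1 - p \<omega>) * V \<omega>) \<partial>M)
      \<le> (\<integral>\<omega>. indicator A \<omega> * (if \<omega> \<in> D then U \<omega> else V \<omega>) \<partial>M)"
proof -
  have space_F: "space F = space M" and sets_F: "sets F \<subseteq> sets M"
    using subalg by (auto simp: subalgebra_def)
  have [measurable]: "p \<in> borel_measurable M"
    by (rule measurable_from_subalg[OF subalg]) measurable
  define W where "W \<omega> = U \<omega> - V \<omega>" for \<omega>
  have [measurable]: "W \<in> borel_measurable M" unfolding W_def by measurable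
  define D where "D = {\<omega>\<in>space F. 0 \<le> real_cond_exp M F W \<omega>}"
  have [measurable]: "D \<in> sets F" unfolding D_def by measurable
  then have [measurable]: "D \<in> sets M" using sets_F by auto
  show ?thesis
  proof (intro bexI ballI)
    fix A assume [measurable]: "A \<in> sets F"
    then have [measurable]: "A \<in> sets M" using sets_F by auto
    \<comment> \<open>The excess weight that the choice by \<open>D\<close> puts on \<open>U\<close>
      compared with the mixture: within \<open>A\<close>, it is \<open>1 - p\<close> on
      \<open>D\<close> and \<open>- p\<close> off it. Its product with the conditional expectation
      of \<open>W\<close> is nonnegative, and being measurable in \<open>F\<close> it integrates
      alike against \<open>W\<close> and against that conditional expectation.\<close>
    define q where "q \<omega> = indicator A \<omega> * (indicator D \<omega> - p \<omega>)" for \<omega>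
    have [measurable]: "q \<in> borel_measurable F" unfolding q_def by measurable
    have [measurable]: "q \<in> borel_measurable M" unfolding q_def by measurable
    have mix_bound: "\<bar>p \<omega> * U \<omega> + (1 - p \<omega>) * V \<omega>\<bar> \<le> 1" if "\<omega> \<in> space M" for \<omega>
    proof -
      have "\<bar>p \<omega> * U \<omega> + (1 - p \<omega>) * V \<omega>\<bar> \<le> p \<omega> * \<bar>U \<omega>\<bar> + (1 - p \<omega>) * \<bar>V \<omega>\<bar>"
        using p[OF that] by (intro order_trans[OF abs_triangle_ineq]) (simp add: abs_mult)
      also have "\<dots> \<le> p \<omega> * 1 + (1 - p \<omega>) * 1"
        using p[OF that] U[OF that] V[OF that] by (intro add_mono mult_left_mono) auto
      finally show ?thesis by simp
    qed
    have int_mix: "integrable M (\<lambda>\<omega>. indicator A \<omega> * (p \<omega> * U \<omega> + (1 - p \<omega>) * V \<omega>))"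
      by (rule integrable_const_bound[where B = 1]) (use mix_bound in \<open>auto simp: indicator_def\<close>)
    have int_D: "integrable M (\<lambda>\<omega>. indicator A \<omega> * (if \<omega> \<in> D then U \<omega> else V \<omega>))"
      by (rule integrable_const_bound[where B = 1]) (use U V in \<open>auto simp: indicator_def\<close>)
    have eq: "indicator A \<omega> * (if \<omega> \<in> D then U \<omega> else V \<omega>) =
        indicator A \<omega> * (p \<omega> * U \<omega> + (1 - p \<omega>) * V \<omega>) + q \<omega> * W \<omega>" for \<omega>
      by (auto simp: q_def W_def indicator_def algebra_simps)
    have int_q: "integrable M (\<lambda>\<omega>. q \<omega> * W \<omega>)"
      using Bochner_Integration.integrable_diff[OF int_D int_mix] unfolding eq by simp
    have "0 \<le> (\<integral>\<omega>. q \<omega> * real_cond_exp M F W \<omega> \<partial>M)"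
    proof (rule Bochner_Integration.integral_nonneg)
      fix \<omega> assume "\<omega> \<in> space M"
      then show "0 \<le> q \<omega> * real_cond_exp M F W \<omega>"
        using p[of \<omega>] by (auto simp: q_def D_def space_F indicator_def mult_nonpos_nonpos
            mult_nonneg_nonpos not_le)
    qed
    also have "\<dots> = (\<integral>\<omega>. q \<omega> * W \<omega> \<partial>M)"
      by (rule real_cond_exp_intg(2)[OF int_q]) measurable
    finally have "0 \<le> (\<integral>\<omega>. q \<omega> * W \<omega> \<partial>M)" .
    then show "(\<integral>\<omega>. indicator A \<omega> * (p \<omega> * U \<omega> + (1 - p \<omega>) * V \<omega>) \<partial>M)
      \<le> (\<integral>\<omega>. indicator A \<omega> * (if \<omega> \<in> D then U \<omega> else V \<omega>) \<partial>M)"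
      unfolding eq using Bochner_Integration.integral_add[OF int_mix int_q] by simp
  qed fact
qed

section \<open>Martingales with values in the unit interval\<close>

locale unit_martingale = prob_space M for M :: "'a measure" +
  fixes F :: "nat \<Rightarrow> 'a measure" and X :: "nat \<Rightarrow> 'a \<Rightarrow> real" and n :: nat
  assumes subalg: "i \<le> n \<Longrightarrow> subalgebra M (F i)"
    and sets_mono: "i \<le> j \<Longrightarrow> j \<le> n \<Longrightarrow> sets (F i) \<subseteq> sets (F j)"
    and adapted: "i \<le> n \<Longrightarrow> X i \<in> borel_measurable (F i)"
    and cond_exp_Suc: "i < n \<Longrightarrow> AE \<omega> in M. real_cond_exp M (F i) (X (Suc i)) \<omega> = X i \<omega>"
    and range: "i \<le> n \<Longrightarrow> \<omega> \<in> space M \<Longrightarrow> X i \<omega> \<in> {0..1}"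
    and final: "\<omega> \<in> space M \<Longrightarrow> X n \<omega> \<in> {0, 1}"
begin

lemma space_F: "i \<le> n \<Longrightarrow> space (F i) = space M"
  using subalg by (auto simp: subalgebra_def)

lemma sets_F: "i \<le> n \<Longrightarrow> A \<in> sets (F i) \<Longrightarrow> A \<in> sets M"
  using subalg by (auto simp: subalgebra_def)

lemma measurable_F_mono:
  "i \<le> j \<Longrightarrow> j \<le> n \<Longrightarrow> Z \<in> borel_measurable (F i) \<Longrightarrow> Z \<in> borel_measurable (F j)"
  using sets_mono[of i j] space_F[of i] space_F[of j]
  by (intro measurable_from_subalg[of "F j" "F i"]) (auto simp: subalgebra_def)

lemma measurable_X: "i \<le> n \<Longrightarrow> X i \<in> borel_measurable M"
  by (rule measurable_from_subalg[OF subalg adapted])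

lemma integrable_bounded:
  assumes "Z \<in> borel_measurable M" "\<And>\<omega>. \<omega> \<in> space M \<Longrightarrow> \<bar>Z \<omega>\<bar> \<le> (1::real)"
  shows "integrable M Z"
  using assms by (intro integrable_const_bound[where B = 1]) auto

text \<open>The martingale property in integrated form: a bounded weight known at time
  \<open>i\<close> may be moved inside the conditional expectation. Thus
  \<open>Z * (X (Suc i) - X i)\<close> integrates to \<open>0\<close>.\<close>

lemma integral_mult_Suc:
  assumes i: "i < n" and Z: "Z \<in> borel_measurable (F i)"
    and bound: "\<And>\<omega>. \<omega> \<in> space M \<Longrightarrow> \<bar>Z \<omega>\<bar> \<le> 1"
  shows "(\<integral>\<omega>. Z \<omega> * X (Suc i) \<omega> \<partial>M) = (\<integral>\<omega>. Z \<omega> * X i \<omega> \<partial>M)"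
proof -
  interpret F: finite_measure_subalgebra M "F i"
    using i by unfold_locales (auto intro: subalg)
  have [measurable]: "Z \<in> borel_measurable M"
    by (rule measurable_from_subalg[OF subalg Z]) (use i in simp)
  have [measurable]: "X i \<in> borel_measurable M" "X (Suc i) \<in> borel_measurable M"
    using i by (auto intro: measurable_X)
  have "integrable M (\<lambda>\<omega>. Z \<omega> * X (Suc i) \<omega>)"
    using i bound range[of "Suc i"]
    by (intro integrable_bounded) (auto simp: abs_mult intro!: mult_le_one)
  then have "(\<integral>\<omega>. Z \<omega> * X (Suc i) \<omega> \<partial>M) = (\<integral>\<omega>. Z \<omega> * real_cond_exp M (F i) (X (Suc i)) \<omega> \<partial>M)"
    by (rule F.real_cond_exp_intg(2)[OF _ Z, symmetric]) measurable
  also have "\<dots> = (\<integral>\<omega>. Z \<omega> * X i \<omega> \<partial>M)"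
    using cond_exp_Suc[OF i] by (intro integral_cong_AE) auto
  finally show ?thesis .
qed

text \<open>Pointwise, the mixture dominates the chord. Integrated over an event known at time
  \<open>i\<close>, the slope term of the chord drops out and
  \<open>curve_transform f (X i \<omega>)\<close> remains; the optimal choice does at least as well
  as the mixture. Since \<open>D\<close> precedes \<open>A\<close> in the quantifiers, one choice
  serves all events.\<close>

lemma exists_good_choice:
  assumes i: "i < n" and f: "admissible_curve f"
  shows "\<exists>D\<in>sets (F i). \<forall>A\<in>sets (F i).
    (\<integral>\<omega>. indicator A \<omega> * curve_transform f (X i \<omega>) \<partial>M) \<le>
    (\<integral>\<omega>. indicator A \<omega> *
      (if \<omega> \<in> D then payoff_low f (X i \<omega>) (X (Suc i) \<omega>) else payoff_high f (X i \<omega>) (X (Suc i) \<omega>)) \<partial>M)"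
proof -
  interpret F: finite_measure_subalgebra M "F i"
    using i by unfold_locales (auto intro: subalg)
  define x where "x = X i"
  define y where "y = X (Suc i)"
  have x: "x \<omega> \<in> {0..1}" and y: "y \<omega> \<in> {0..1}" if "\<omega> \<in> space M" for \<omega>
    unfolding x_def y_def using range that i by (auto simp del: atLeastAtMost_iff)
  have xF[measurable]: "x \<in> borel_measurable (F i)" unfolding x_def using i by (auto intro: adapted)
  have xM[measurable]: "x \<in> borel_measurable M" unfolding x_def using i by (auto intro: measurable_X)
  have yM[measurable]: "y \<in> borel_measurable M" unfolding y_def using i by (auto intro: measurable_X)
  have xF_range: "x \<omega> \<in> {0..1}" if "\<omega> \<in> space (F i)" for \<omega>
    using x that i by (auto simp: space_F simp del: atLeastAtMost_iff)
  define U where "U \<omega> = payoff_low f (x \<omega>) (y \<omega>)" for \<omega>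
  define V where "V \<omega> = payoff_high f (x \<omega>) (y \<omega>)" for \<omega>
  define p where "p \<omega> = mix_weight f (x \<omega>)" for \<omega>
  define s where "s \<omega> = chord_slope f (x \<omega>)" for \<omega>
  have U[measurable]: "U \<in> borel_measurable M" and V[measurable]: "V \<in> borel_measurable M"
    unfolding U_def V_def
    by (rule borel_measurable_payoff_low borel_measurable_payoff_high; (rule f xM yM x y)?; assumption)+
  have p[measurable]: "p \<in> borel_measurable (F i)" and s[measurable]: "s \<in> borel_measurable (F i)"
    unfolding p_def s_def
    by (rule borel_measurable_mix_weight borel_measurable_chord_slope; (rule f xF xF_range)?; assumption)+
  have [measurable]: "p \<in> borel_measurable M" "s \<in> borel_measurable M"
    by (rule measurable_from_subalg[OF F.subalg]; measurable)+
  have bounds: "\<bar>U \<omega>\<bar> \<le> 1" "\<bar>V \<omega>\<bar> \<le> 1" "0 \<le> p \<omega> \<and> p \<omega> \<le> 1" "\<bar>s \<omega>\<bar> \<le> 1" if "\<omega> \<in> space M" for \<omega>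
    using payoff_bounds[OF f x[OF that] y[OF that]] mix_weight_bounds[OF f x[OF that]]
      abs_chord_slope_le_1[OF f x[OF that]] by (auto simp: U_def V_def p_def s_def)
  obtain D where D: "D \<in> sets (F i)" and opt: "\<And>A. A \<in> sets (F i) \<Longrightarrow>
      (\<integral>\<omega>. indicator A \<omega> * (p \<omega> * U \<omega> + (1 - p \<omega>) * V \<omega>) \<partial>M)
        \<le> (\<integral>\<omega>. indicator A \<omega> * (if \<omega> \<in> D then U \<omega> else V \<omega>) \<partial>M)"
    using F.exists_optimal_choice[OF U V p bounds(1-3)] by blast
  have tf: "admissible_curve (curve_transform f)" by (rule admissible_curve_transform[OF f])
  have g[measurable]: "(\<lambda>\<omega>. curve_transform f (x \<omega>)) \<in> borel_measurable M"
    by (rule borel_measurable_admissible_curve[OF tf xM x])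
  show ?thesis
    unfolding x_def[symmetric] y_def[symmetric] U_def[symmetric] V_def[symmetric]
  proof (intro bexI[OF _ D] ballI)
    fix A assume A[measurable]: "A \<in> sets (F i)"
    then have [measurable]: "A \<in> sets M" using i sets_F[OF _ A] by simp
    have int_g: "integrable M (\<lambda>\<omega>. indicator A \<omega> * curve_transform f (x \<omega>))"
      using admissible_curve_nonneg[OF tf x] admissible_curve_le_1[OF tf x]
      by (intro integrable_bounded) (auto simp: indicator_def)
    have int_sx: "integrable M (\<lambda>\<omega>. indicator A \<omega> * s \<omega> * x \<omega>)"
      using bounds(4) x by (intro integrable_bounded) (auto simp: indicator_def abs_mult intro!: mult_le_one)
    have int_sy: "integrable M (\<lambda>\<omega>. indicator A \<omega> * s \<omega> * y \<omega>)"
      using bounds(4) y by (intro integrable_bounded) (auto simp: indicator_def abs_mult intro!: mult_le_one)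
    have int_mix: "integrable M (\<lambda>\<omega>. indicator A \<omega> * (p \<omega> * U \<omega> + (1 - p \<omega>) * V \<omega>))"
    proof (rule integrable_const_bound[where B = 2])
      have "\<bar>p \<omega> * U \<omega> + (1 - p \<omega>) * V \<omega>\<bar> \<le> 2" if "\<omega> \<in> space M" for \<omega>
      proof -
        have "\<bar>p \<omega> * U \<omega>\<bar> \<le> 1" "\<bar>(1 - p \<omega>) * V \<omega>\<bar> \<le> 1"
          using bounds[OF that] by (auto simp: abs_mult intro!: mult_le_one)
        then show ?thesis by linarith
      qed
      then show "AE \<omega> in M. norm (indicator A \<omega> * (p \<omega> * U \<omega> + (1 - p \<omega>) * V \<omega>)) \<le> 2"
        by (auto simp: indicator_def)
    qed measurable
    have eq: "(\<integral>\<omega>. indicator A \<omega> * s \<omega> * y \<omega> \<partial>M) = (\<integral>\<omega>. indicator A \<omega> * s \<omega> * x \<omega> \<partial>M)"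
      unfolding x_def y_def using bounds(4)
      by (intro integral_mult_Suc i) (auto simp: indicator_def)
    have "(\<integral>\<omega>. indicator A \<omega> * curve_transform f (x \<omega>) \<partial>M)
      = (\<integral>\<omega>. indicator A \<omega> * curve_transform f (x \<omega>) + (indicator A \<omega> * s \<omega> * y \<omega> - indicator A \<omega> * s \<omega> * x \<omega>) \<partial>M)"
      using int_g int_sx int_sy eq by simp
    also have "\<dots> \<le> (\<integral>\<omega>. indicator A \<omega> * (p \<omega> * U \<omega> + (1 - p \<omega>) * V \<omega>) \<partial>M)"
    proof (rule integral_mono)
      fix \<omega> assume "\<omega> \<in> space M"
      then show "indicator A \<omega> * curve_transform f (x \<omega>) + (indicator A \<omega> * s \<omega> * y \<omega> - indicator A \<omega> * s \<omega> * x \<omega>)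
          \<le> indicator A \<omega> * (p \<omega> * U \<omega> + (1 - p \<omega>) * V \<omega>)"
        using mixed_payoff_ge_chord[OF f x y, of \<omega> \<omega>]
        by (auto simp: indicator_def U_def V_def p_def s_def algebra_simps)
    qed (use int_g int_sx int_sy int_mix in auto)
    also have "\<dots> \<le> (\<integral>\<omega>. indicator A \<omega> * (if \<omega> \<in> D then U \<omega> else V \<omega>) \<partial>M)"
      by (rule opt[OF A])
    finally show "(\<integral>\<omega>. indicator A \<omega> * curve_transform f (x \<omega>) \<partial>M)
      \<le> (\<integral>\<omega>. indicator A \<omega> * (if \<omega> \<in> D then U \<omega> else V \<omega>) \<partial>M)" .
  qed
qed

text \<open>\<open>D i\<close> is the event, known at time \<open>i\<close>, on which rule (a)
  governs step \<open>Suc i\<close>; rule (b) governs it elsewhere. The last step is left out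
  because no continuation curve belongs to it. All events \<open>A\<close> are included so that the
  inequality can be localised to the outcomes not yet stopped.\<close>

definition good_choice :: "(nat \<Rightarrow> 'a set) \<Rightarrow> bool" where
  "good_choice D \<longleftrightarrow> (\<forall>i. Suc i < n \<longrightarrow> D i \<in> sets (F i) \<and> (\<forall>A\<in>sets (F i).
    (\<integral>\<omega>. indicator A \<omega> * C' (n - i) (X i \<omega>) \<partial>M) \<le>
    (\<integral>\<omega>. indicator A \<omega> *
      (if \<omega> \<in> D i then payoff_low (C' (n - Suc i)) (X i \<omega>) (X (Suc i) \<omega>)
       else payoff_high (C' (n - Suc i)) (X i \<omega>) (X (Suc i) \<omega>)) \<partial>M)))"

lemma good_choiceD:
  assumes "good_choice D" "Suc i < n"
  shows "D i \<in> sets (F i)"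
    and "A \<in> sets (F i) \<Longrightarrow> (\<integral>\<omega>. indicator A \<omega> * C' (n - i) (X i \<omega>) \<partial>M) \<le>
    (\<integral>\<omega>. indicator A \<omega> *
      (if \<omega> \<in> D i then payoff_low (C' (n - Suc i)) (X i \<omega>) (X (Suc i) \<omega>)
       else payoff_high (C' (n - Suc i)) (X i \<omega>) (X (Suc i) \<omega>)) \<partial>M)"
  by (fact assms(1)[unfolded good_choice_def, rule_format, OF assms(2), THEN conjunct1]
    assms(1)[unfolded good_choice_def, rule_format, OF assms(2), THEN conjunct2, rule_format])+

lemma exists_good_choice_family: "\<exists>D. good_choice D"
proof -
  have "\<exists>D. Suc i < n \<longrightarrow> D \<in> sets (F i) \<and> (\<forall>A\<in>sets (F i).
    (\<integral>\<omega>. indicator A \<omega> * C' (n - i) (X i \<omega>) \<partial>M) \<le>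
    (\<integral>\<omega>. indicator A \<omega> *
      (if \<omega> \<in> D then payoff_low (C' (n - Suc i)) (X i \<omega>) (X (Suc i) \<omega>)
       else payoff_high (C' (n - Suc i)) (X i \<omega>) (X (Suc i) \<omega>)) \<partial>M))" for i
  proof (cases "Suc i < n")
    case True
    then have "C' (n - i) = curve_transform (C' (n - Suc i))"
      using C'_Suc[of "n - Suc i"] by (simp add: Suc_diff_Suc)
    then show ?thesis
      using exists_good_choice[of i "C' (n - Suc i)"] admissible_curve_C'[of "n - Suc i"] True by auto
  qed auto
  then show ?thesis unfolding good_choice_def by (intro choice allI)
qed

text \<open>The rule for time \<open>k \<ge> 1\<close> is fixed by \<open>D (k - 1)\<close>, with
  curve index \<open>n - (k - 1) - 1 = n - k\<close>. At the last time, stopping at \<open>0\<close>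
  is chosen on every prefix.\<close>

definition stop_set :: "(nat \<Rightarrow> 'a set) \<Rightarrow> nat \<Rightarrow> 'a set" where
  "stop_set D k = (if k < n
     then {\<omega>\<in>space M. if \<omega> \<in> D (k - 1) then X k \<omega> \<le> left_sol (C' (n - k)) (X (k - 1) \<omega>)
       else X k \<omega> \<ge> right_sol (C' (n - k)) (X (k - 1) \<omega>)}
     else {\<omega>\<in>space M. X k \<omega> = 0})"

lemma stop_set_measurable:
  assumes D: "good_choice D" and k: "1 \<le> k" "k \<le> n"
  shows "stop_set D k \<in> sets (F k)"
proof -
  have Xk[measurable]: "X k \<in> borel_measurable (F k)" by (rule adapted) fact
  show ?thesis
  proof (cases "k < n")
    case True
    have X: "X (k - 1) \<in> borel_measurable (F k)"
      using k by (intro measurable_F_mono[of "k - 1" k] adapted) auto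
    have "Suc (k - 1) < n" using True k by simp
    then have "D (k - 1) \<in> sets (F (k - 1))" by (rule good_choiceD(1)[OF D])
    then have [measurable]: "D (k - 1) \<in> sets (F k)"
      using sets_mono[of "k - 1" k] k by auto
    have C: "admissible_curve (C' (n - k))" using True by (intro admissible_curve_C') simp
    have r: "X (k - 1) \<omega> \<in> {0..1}" if "\<omega> \<in> space (F k)" for \<omega>
      using that k range[of "k - 1"] space_F[of k] by auto
    note [measurable] = borel_measurable_left_sol[OF C X r] borel_measurable_right_sol[OF C X r]
    have "{\<omega>\<in>space (F k). if \<omega> \<in> D (k - 1) then X k \<omega> \<le> left_sol (C' (n - k)) (X (k - 1) \<omega>)
       else X k \<omega> \<ge> right_sol (C' (n - k)) (X (k - 1) \<omega>)} \<in> sets (F k)"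
      by measurable
    then show ?thesis
      using True by (simp add: stop_set_def space_F[OF k(2)])
  next
    case False
    then show ?thesis
      unfolding stop_set_def space_F[OF k(2), symmetric] by simp
  qed
qed

lemma jump_at_first_hit:
  assumes S: "\<And>k. 1 \<le> k \<Longrightarrow> k \<le> n \<Longrightarrow> S k \<in> sets M" and "i + r \<le> n"
  shows "jump_at X (first_hit S i r) \<in> borel_measurable M"
    and "\<And>\<omega>. \<omega> \<in> space M \<Longrightarrow> jump_at X (first_hit S i r) \<omega> \<in> {0..1}"
  using assms(2)
proof (induction r arbitrary: i)
  case 0
  { case 1
    have "jump_at X (first_hit S i 0) = (\<lambda>_. 0)" by (rule ext) (rule jump_at_first_hit_0)
    then show ?case by simp }
  { case 2 show ?case by (simp add: jump_at_first_hit_0) }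
next
  case (Suc r)
  { case 1
    then have [measurable]: "S (Suc i) \<in> sets M" "X (Suc i) \<in> borel_measurable M"
        "X i \<in> borel_measurable M" "jump_at X (first_hit S (Suc i) r) \<in> borel_measurable M"
      by (auto intro: S measurable_X Suc.IH(1))
    have "jump_at X (first_hit S i (Suc r)) = (\<lambda>\<omega>. if \<omega> \<in> S (Suc i) then \<bar>X (Suc i) \<omega> - X i \<omega>\<bar>
        else jump_at X (first_hit S (Suc i) r) \<omega>)"
      by (rule ext) (rule jump_at_first_hit_Suc)
    then show ?case by simp }
  { case 2
    then show ?case
      using Suc.IH(2)[of \<omega> "Suc i"] range[of i \<omega>] range[of "Suc i" \<omega>]
      by (auto simp: jump_at_first_hit_Suc) }
qed

text \<open>Backward induction from time \<open>n - 1\<close>. The event \<open>A\<close> stays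
  arbitrary because the step needs the bound for the part of \<open>A\<close> on which the process
  goes on.\<close>

lemma C'_le_integral_jump:
  assumes D: "good_choice D" and i: "i < n" and A: "A \<in> sets (F i)"
  shows "(\<integral>\<omega>. indicator A \<omega> * C' (n - i) (X i \<omega>) \<partial>M)
    \<le> (\<integral>\<omega>. indicator A \<omega> * jump_at X (first_hit (stop_set D) i (n - i)) \<omega> \<partial>M)"
proof -
  have S: "stop_set D k \<in> sets M" if "1 \<le> k" "k \<le> n" for k
    using stop_set_measurable[OF D that] sets_F that by auto
  note jump = jump_at_first_hit[of "stop_set D", OF S]
  have "i \<le> n - 1" using i by simp
  then show ?thesis
    using A
  proof (induction i arbitrary: A rule: inc_induct)
    case base
    define m where "m = n - 1"
    have n: "n = Suc m" using i by (simp add: m_def)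
    have A[measurable]: "A \<in> sets (F m)" using base by (simp add: m_def)
    have [measurable]: "A \<in> sets M" using n sets_F[OF _ A] by simp
    have [measurable]: "X m \<in> borel_measurable (F m)" "X m \<in> borel_measurable M" "X n \<in> borel_measurable M"
      using n by (auto intro: adapted measurable_X)
    have r: "X m \<omega> \<in> {0..1}" "X n \<omega> \<in> {0..1}" if "\<omega> \<in> space M" for \<omega>
      using range[of m \<omega>] range[of n \<omega>] that n by auto
    have int: "integrable M (\<lambda>\<omega>. indicator A \<omega> * X m \<omega>)"
      "integrable M (\<lambda>\<omega>. indicator A \<omega> * X m \<omega> * X m \<omega>)"
      "integrable M (\<lambda>\<omega>. indicator A \<omega> * X m \<omega> * X n \<omega>)"
      using r by (auto intro!: integrable_bounded simp: indicator_def abs_mult mult_le_one)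
    have "(\<integral>\<omega>. indicator A \<omega> * C' 1 (X m \<omega>) \<partial>M)
        = (\<integral>\<omega>. indicator A \<omega> * X m \<omega> - indicator A \<omega> * X m \<omega> * X m \<omega> \<partial>M)"
      unfolding C'_1 by (simp add: algebra_simps)
    \<comment> \<open>One factor \<open>X m\<close> is replaced by \<open>X n\<close>, by the
      martingale property with weight \<open>X m\<close> on \<open>A\<close>. The result
      \<open>X m * (1 - X n)\<close> is exactly the jump to \<open>0\<close>, as \<open>X n\<close>
      takes only the values \<open>0\<close> and \<open>1\<close>.\<close>
    also have "\<dots> = (\<integral>\<omega>. indicator A \<omega> * X m \<omega> - indicator A \<omega> * X m \<omega> * X n \<omega> \<partial>M)"
      using int integral_mult_Suc[of m "\<lambda>\<omega>. indicator A \<omega> * X m \<omega>"] r n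
      by (simp add: indicator_def)
    also have "\<dots> = (\<integral>\<omega>. indicator A \<omega> * jump_at X (first_hit (stop_set D) m 1) \<omega> \<partial>M)"
    proof (intro Bochner_Integration.integral_cong refl)
      fix \<omega> assume \<omega>: "\<omega> \<in> space M"
      have "\<omega> \<in> stop_set D n \<longleftrightarrow> X n \<omega> = 0" using \<omega> by (simp add: stop_set_def)
      then have "jump_at X (first_hit (stop_set D) m 1) \<omega> = (if X n \<omega> = 0 then X m \<omega> else 0)"
        using r(1)[OF \<omega>] jump_at_first_hit_Suc[of X "stop_set D" m 0 \<omega>]
        by (simp add: jump_at_first_hit_0 n[symmetric])
      then show "indicator A \<omega> * X m \<omega> - indicator A \<omega> * X m \<omega> * X n \<omega>
          = indicator A \<omega> * jump_at X (first_hit (stop_set D) m 1) \<omega>"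
        using final[OF \<omega>] by auto
    qed
    moreover have "n - (n - 1) = 1" using n by simp
    ultimately show ?case unfolding m_def[symmetric] by simp
  next
    case (step i)
    then have i: "Suc i < n" by simp
    define f where "f = C' (n - Suc i)"
    have f: "admissible_curve f" unfolding f_def using i by (intro admissible_curve_C') simp
    define S where "S = stop_set D (Suc i)"
    define J where "J = jump_at X (first_hit (stop_set D) (Suc i) (n - Suc i))"
    have SF[measurable]: "S \<in> sets (F (Suc i))"
      unfolding S_def using i by (intro stop_set_measurable[OF D]) auto
    have AF[measurable]: "A \<in> sets (F (Suc i))"
      using step.prems sets_mono[of i "Suc i"] i by auto
    have [measurable]: "S \<in> sets M" "A \<in> sets M"
      using i by (auto intro: sets_F[OF _ SF] sets_F[OF _ AF])
    have XM[measurable]: "X i \<in> borel_measurable M" "X (Suc i) \<in> borel_measurable M"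
      using i by (auto intro: measurable_X)
    have r: "X i \<omega> \<in> {0..1}" "X (Suc i) \<omega> \<in> {0..1}" if "\<omega> \<in> space M" for \<omega>
      using range[of i \<omega>] range[of "Suc i" \<omega>] that i by auto
    have [measurable]: "(\<lambda>\<omega>. f (X (Suc i) \<omega>)) \<in> borel_measurable M"
      by (rule borel_measurable_admissible_curve[OF f XM(2) r(2)])
    have J[measurable]: "J \<in> borel_measurable M"
      unfolding J_def using i by (intro jump(1)) auto
    have J_range: "J \<omega> \<in> {0..1}" if "\<omega> \<in> space M" for \<omega>
      unfolding J_def using i that by (intro jump(2)) auto
    have f_range: "f (X (Suc i) \<omega>) \<in> {0..1}" if "\<omega> \<in> space M" for \<omega>
      using admissible_curve_nonneg[OF f r(2)[OF that]] admissible_curve_le_1[OF f r(2)[OF that]] by simp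
    have "\<bar>X (Suc i) \<omega> - X i \<omega>\<bar> \<le> 1" if "\<omega> \<in> space M" for \<omega>
      using r[OF that] by auto
    then have int_now: "integrable M (\<lambda>\<omega>. indicator (A \<inter> S) \<omega> * \<bar>X (Suc i) \<omega> - X i \<omega>\<bar>)"
      by (intro integrable_bounded) (auto simp: indicator_def)
    have int_f: "integrable M (\<lambda>\<omega>. indicator (A - S) \<omega> * f (X (Suc i) \<omega>))"
      using f_range by (intro integrable_bounded) (auto simp: indicator_def)
    have int_J: "integrable M (\<lambda>\<omega>. indicator (A - S) \<omega> * J \<omega>)"
      using J_range by (intro integrable_bounded) (auto simp: indicator_def)
    have "(\<integral>\<omega>. indicator A \<omega> * C' (n - i) (X i \<omega>) \<partial>M) \<le>
        (\<integral>\<omega>. indicator A \<omega> *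
        (if \<omega> \<in> D i then payoff_low f (X i \<omega>) (X (Suc i) \<omega>)
         else payoff_high f (X i \<omega>) (X (Suc i) \<omega>)) \<partial>M)"
      unfolding f_def by (rule good_choiceD(2)[OF D i step.prems])
    \<comment> \<open>On \<open>S\<close> the selected payoff is the jump and off \<open>S\<close>
      it is \<open>f\<close> at the new value, since \<open>S\<close> tests the very inequality in
      the payoff that \<open>D i\<close> selects.\<close>
    also have "\<dots> = (\<integral>\<omega>. indicator (A \<inter> S) \<omega> * \<bar>X (Suc i) \<omega> - X i \<omega>\<bar>
        + indicator (A - S) \<omega> * f (X (Suc i) \<omega>) \<partial>M)"
      using i by (intro Bochner_Integration.integral_cong refl)
        (auto simp: indicator_def S_def stop_set_def payoff_low_def payoff_high_def f_def)
    also have "\<dots> = (\<integral>\<omega>. indicator (A \<inter> S) \<omega> * \<bar>X (Suc i) \<omega> - X i \<omega>\<bar> \<partial>M)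
        + (\<integral>\<omega>. indicator (A - S) \<omega> * f (X (Suc i) \<omega>) \<partial>M)"
      by (rule Bochner_Integration.integral_add[OF int_now int_f])
    \<comment> \<open>\<open>A - S\<close> is known at time \<open>Suc i\<close>, so the induction
      hypothesis replaces the curve value there by the future jump.\<close>
    also have "\<dots> \<le> (\<integral>\<omega>. indicator (A \<inter> S) \<omega> * \<bar>X (Suc i) \<omega> - X i \<omega>\<bar> \<partial>M)
        + (\<integral>\<omega>. indicator (A - S) \<omega> * J \<omega> \<partial>M)"
      unfolding f_def J_def by (intro add_left_mono step.IH) measurable
    also have "\<dots> = (\<integral>\<omega>. indicator (A \<inter> S) \<omega> * \<bar>X (Suc i) \<omega> - X i \<omega>\<bar>
        + indicator (A - S) \<omega> * J \<omega> \<partial>M)"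
      by (rule Bochner_Integration.integral_add[OF int_now int_J, symmetric])
    also have "\<dots> = (\<integral>\<omega>. indicator A \<omega> * jump_at X (first_hit (stop_set D) i (Suc (n - Suc i))) \<omega> \<partial>M)"
      by (intro Bochner_Integration.integral_cong refl)
        (auto simp: jump_at_first_hit_Suc J_def S_def indicator_def)
    finally show ?case using i by (simp add: Suc_diff_Suc)
  qed
qed

end

subsection \<open>The filtration generated by the observations\<close>

lemma measurable_prefix:
  fixes n :: nat
  assumes "\<forall>i\<in>{1..n}. E i \<in> measurable M (N i)" "i \<le> n"
  shows "(\<lambda>\<omega>. \<lambda>j\<in>{1..i}. E j \<omega>) \<in> measurable M (Pi\<^sub>M {1..i} N)"
  by (intro measurable_restrict assms(1)[rule_format]) (use assms(2) in simp)

lemma sets_gen_sigma: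
  assumes "\<forall>i\<in>{1..n}. E i \<in> measurable M (N i)" "i \<le> n"
  shows "sets (gen_sigma M N E i)
    = {(\<lambda>\<omega>. \<lambda>j\<in>{1..i}. E j \<omega>) -` A \<inter> space M | A. A \<in> sets (Pi\<^sub>M {1..i} N)}"
  unfolding gen_sigma_def
  by (intro sets_vimage_algebra2 Pi_I measurable_space[OF measurable_prefix[OF assms]])

lemma subalgebra_gen_sigma:
  assumes "\<forall>i\<in>{1..n}. E i \<in> measurable M (N i)" "i \<le> n"
  shows "subalgebra M (gen_sigma M N E i)"
  using sets_image_in_sets[OF refl measurable_prefix[OF assms]]
  by (simp add: subalgebra_def gen_sigma_def)

lemma sets_gen_sigma_mono:
  assumes E: "\<forall>i\<in>{1..n}. E i \<in> measurable M (N i)" and ij: "i \<le> j" "j \<le> n"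
  shows "sets (gen_sigma M N E i) \<subseteq> sets (gen_sigma M N E j)"
proof -
  have "(\<lambda>\<omega>. \<lambda>k\<in>{1..j}. E k \<omega>) \<in> measurable (gen_sigma M N E j) (Pi\<^sub>M {1..j} N)"
    unfolding gen_sigma_def
    by (intro measurable_vimage_algebra1 Pi_I measurable_space[OF measurable_prefix[OF E ij(2)]])
  then have "(\<lambda>\<omega>. restrict (\<lambda>k\<in>{1..j}. E k \<omega>) {1..i}) \<in> measurable (gen_sigma M N E j) (Pi\<^sub>M {1..i} N)"
    by (rule measurable_compose[OF _ measurable_restrict_subset]) (use ij in auto)
  moreover have "{1..j} \<inter> {1..i} = {1..i}" using ij by auto
  ultimately have "(\<lambda>\<omega>. \<lambda>k\<in>{1..i}. E k \<omega>) \<in> measurable (gen_sigma M N E j) (Pi\<^sub>M {1..i} N)"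
    by (simp only: restrict_restrict)
  then show ?thesis
    unfolding gen_sigma_def[of M N E i] by (rule sets_image_in_sets[rotated]) (simp add: gen_sigma_def)
qed

text \<open>Every such set is a preimage under the prefix map, hence a union of prefix
  classes.\<close>

lemma gen_sigma_same_prefix:
  assumes E: "\<forall>i\<in>{1..n}. E i \<in> measurable M (N i)" "i \<le> n"
    and A: "A \<in> sets (gen_sigma M N E i)" and \<omega>: "\<omega> \<in> space M" "\<omega>' \<in> same_prefix M E i \<omega>"
  shows "\<omega>' \<in> A \<longleftrightarrow> \<omega> \<in> A"
proof -
  have "(\<lambda>j\<in>{1..i}. E j \<omega>') = (\<lambda>j\<in>{1..i}. E j \<omega>)"
    using \<omega> by (auto simp: same_prefix_def fun_eq_iff)
  then show ?thesis
    using A \<omega> unfolding sets_gen_sigma[OF E] by (auto simp: same_prefix_def)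
qed

text \<open>The level set of \<open>Y\<close> through \<open>\<omega>\<close> is a union of prefix
  classes. For \<open>i = 0\<close> all outcomes share the empty prefix, and \<open>Y\<close> is
  constant.\<close>

lemma measurable_gen_sigma_same_prefix:
  fixes Y :: "'a \<Rightarrow> real"
  assumes E: "\<forall>i\<in>{1..n}. E i \<in> measurable M (N i)" "i \<le> n"
    and [measurable]: "Y \<in> borel_measurable (gen_sigma M N E i)"
    and \<omega>: "\<omega> \<in> space M" "\<omega>' \<in> same_prefix M E i \<omega>"
  shows "Y \<omega>' = Y \<omega>"
proof -
  have "{\<omega>''\<in>space (gen_sigma M N E i). Y \<omega>'' = Y \<omega>} \<in> sets (gen_sigma M N E i)"
    by measurable
  from gen_sigma_same_prefix[OF E this \<omega>] show ?thesis
    using \<omega> by (auto simp: gen_sigma_def)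
qed

section \<open>The supremum over specialized stopping times\<close>

lemma (in prob_space) jump_at_expectation_le_1:
  assumes \<tau>: "\<And>\<omega>. \<omega> \<in> space M \<Longrightarrow> \<tau> \<omega> \<in> insert \<infinity> (enat ` {1..n})"
    and X: "\<And>i \<omega>. i \<le> n \<Longrightarrow> \<omega> \<in> space M \<Longrightarrow> X i \<omega> \<in> {0..1}"
  shows "expectation (jump_at X \<tau>) \<le> 1"
proof (cases "integrable M (jump_at X \<tau>)")
  case True
  have "jump_at X \<tau> \<omega> \<le> 1" if "\<omega> \<in> space M" for \<omega>
  proof (cases "\<tau> \<omega>")
    case (enat k)
    then have "k \<le> n" using \<tau>[OF that] by auto
    then have "X k \<omega> \<in> {0..1}" "X (k - 1) \<omega> \<in> {0..1}" using that by (auto intro!: X simp del: atLeastAtMost_iff)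
    then have "\<bar>X k \<omega> - X (k - 1) \<omega>\<bar> \<le> 1" unfolding atLeastAtMost_iff by linarith
    then show ?thesis by (simp add: jump_at_def enat)
  qed (simp add: jump_at_def)
  then have "AE \<omega> in M. jump_at X \<tau> \<omega> \<le> 1" by (intro AE_I2)
  then show ?thesis by (rule integral_le_const[OF True])
qed (simp add: not_integrable_integral_eq)

text \<open>If an outcome has not stopped by time \<open>i\<close>, no outcome with the same prefix
  has, because the stop sets up to time \<open>i\<close> are unions of prefix classes. On this class
  \<open>D i\<close> and \<open>X i\<close> are constant too, so a single rule with a single
  threshold decides about time \<open>i + 1\<close>.\<close>

lemma (in unit_martingale) specialized_first_hit:
  assumes F: "\<And>i. F i = gen_sigma M N E i" and E: "\<forall>i\<in>{1..n}. E i \<in> measurable M (N i)"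
    and D: "good_choice D"
  shows "specialized M N E n X (first_hit (stop_set D) 0 n)"
  unfolding specialized_def
proof (intro conjI ballI allI impI)
  show "first_hit (stop_set D) 0 n \<omega> \<in> insert \<infinity> (enat ` {1..n})" for \<omega>
    by (rule first_hit_range)
next
  fix k assume k: "k \<in> {1..n}"
  have "stop_set D j \<in> sets (F k)" if "j \<in> {1..k}" for j
    using stop_set_measurable[OF D, of j] sets_mono[of j k] that k by auto
  then have "(\<Union>j\<in>{1..k}. stop_set D j) \<in> sets (F k)" by auto
  also have "(\<Union>j\<in>{1..k}. stop_set D j) = {\<omega>\<in>space M. first_hit (stop_set D) 0 n \<omega> \<le> enat k}"
    using k by (auto simp: first_hit_le_iff) (auto simp: stop_set_def split: if_splits)
  finally show "{\<omega>\<in>space M. first_hit (stop_set D) 0 n \<omega> \<le> enat k} \<in> sets (gen_sigma M N E k)"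
    by (simp add: F)
next
  fix i \<omega> assume i: "i < n" and \<omega>: "\<omega> \<in> space M" and "enat i < first_hit (stop_set D) 0 n \<omega>"
  then have no_hit: "\<omega> \<notin> stop_set D j" if "j \<in> {1..i}" for j
    using first_hit_le_iff[of i n "stop_set D" \<omega>] that by (auto simp: not_le[symmetric])
  have hit: "first_hit (stop_set D) 0 n \<omega>' = enat (i + 1) \<longleftrightarrow> \<omega>' \<in> stop_set D (i + 1)"
    if \<omega>': "\<omega>' \<in> same_prefix M E i \<omega>" for \<omega>'
  proof -
    have "\<omega>' \<notin> stop_set D j" if j: "j \<in> {1..i}" for j
    proof -
      have "stop_set D j \<in> sets (gen_sigma M N E i)"
        using stop_set_measurable[OF D, of j] sets_mono[of j i] j i by (auto simp: F)
      from gen_sigma_same_prefix[OF E less_imp_le[OF i] this \<omega> \<omega>'] show ?thesis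
        using no_hit[OF j] by simp
    qed
    then show ?thesis using i by (auto simp: first_hit_eq_enat_iff)
  qed
  have X: "X i \<omega>' = X i \<omega>" if \<omega>': "\<omega>' \<in> same_prefix M E i \<omega>" for \<omega>'
    using measurable_gen_sigma_same_prefix[OF E less_imp_le[OF i] _ \<omega> \<omega>', of "X i"] adapted[of i] i
    by (simp add: F)
  have sp: "\<omega>' \<in> space M" if "\<omega>' \<in> same_prefix M E i \<omega>" for \<omega>'
    using that by (simp add: same_prefix_def)
  show "if i < n - 1 then
           (let x = X i \<omega>;
                x\<^sub>0 = left_sol (C' (n - i - 1)) x;
                x\<^sub>1 = right_sol (C' (n - i - 1)) x
            in (\<forall>\<omega>'\<in>same_prefix M E i \<omega>. first_hit (stop_set D) 0 n \<omega>' = enat (i + 1) \<longleftrightarrow> X (i + 1) \<omega>' \<le> x\<^sub>0) \<or>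
               (\<forall>\<omega>'\<in>same_prefix M E i \<omega>. first_hit (stop_set D) 0 n \<omega>' = enat (i + 1) \<longleftrightarrow> X (i + 1) \<omega>' \<ge> x\<^sub>1))
         else
           (\<forall>\<omega>'\<in>same_prefix M E i \<omega>. first_hit (stop_set D) 0 n \<omega>' = enat n \<longleftrightarrow> X n \<omega>' = 0) \<or>
           (\<forall>\<omega>'\<in>same_prefix M E i \<omega>. first_hit (stop_set D) 0 n \<omega>' = enat n \<longleftrightarrow> X n \<omega>' = 1)"
  proof (cases "i < n - 1")
    case True
    then have "D i \<in> sets (gen_sigma M N E i)"
      using good_choiceD(1)[OF D, of i] by (simp add: F)
    from gen_sigma_same_prefix[OF E less_imp_le[OF i] this \<omega>]
    have D_eq: "\<omega>' \<in> D i \<longleftrightarrow> \<omega> \<in> D i" if "\<omega>' \<in> same_prefix M E i \<omega>" for \<omega>'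
      using that by simp
    have "first_hit (stop_set D) 0 n \<omega>' = enat (i + 1) \<longleftrightarrow>
        (if \<omega> \<in> D i then X (i + 1) \<omega>' \<le> left_sol (C' (n - i - 1)) (X i \<omega>)
         else X (i + 1) \<omega>' \<ge> right_sol (C' (n - i - 1)) (X i \<omega>))"
      if \<omega>': "\<omega>' \<in> same_prefix M E i \<omega>" for \<omega>'
      unfolding hit[OF \<omega>'] using D_eq[OF \<omega>'] X[OF \<omega>'] sp[OF \<omega>'] True
      by (auto simp: stop_set_def)
    then show ?thesis using True by (cases "\<omega> \<in> D i") (auto simp: Let_def)
  next
    case False
    then have n: "n = i + 1" using i by simp
    have "first_hit (stop_set D) 0 n \<omega>' = enat n \<longleftrightarrow> X n \<omega>' = 0"
      if \<omega>': "\<omega>' \<in> same_prefix M E i \<omega>" for \<omega>'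
      using hit[OF \<omega>'] sp[OF \<omega>'] unfolding n[symmetric] by (simp add: stop_set_def)
    then show ?thesis using False by simp
  qed
qed

theorem theorem3:
  fixes M :: "'a measure" and N :: "nat \<Rightarrow> 'b measure"
    and E :: "nat \<Rightarrow> 'a \<Rightarrow> 'b" and X :: "nat \<Rightarrow> 'a \<Rightarrow> real" and n :: nat
  assumes "prob_space M"
    and "n \<ge> 1"
    and "martingale_wrt M N E n X"
    and "\<And>i \<omega>. i \<in> {1..n} \<Longrightarrow> \<omega> \<in> space M \<Longrightarrow> X i \<omega> \<in> {0..1}"
    and "\<And>\<omega>. \<omega> \<in> space M \<Longrightarrow> X n \<omega> \<in> {0, 1}"
  shows "\<forall>\<omega>\<^sub>0\<in>space M.
    (SUP \<tau>\<in>{\<tau>. specialized M N E n X \<tau>}. prob_space.expectation M (jump_at X \<tau>)) \<ge> C' n (X 0 \<omega>\<^sub>0)"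
proof
  fix \<omega>\<^sub>0 assume \<omega>\<^sub>0: "\<omega>\<^sub>0 \<in> space M"
  interpret prob_space M by fact
  define F where "F = gen_sigma M N E"
  define c where "c = X 0 \<omega>\<^sub>0"
  have E: "\<forall>i\<in>{1..n}. E i \<in> measurable M (N i)"
    using assms(3) by (simp add: martingale_wrt_def)
  have adapted: "X i \<in> borel_measurable (F i)" and int: "integrable M (X i)" if "i \<le> n" for i
    using assms(3) that by (simp_all add: martingale_wrt_def F_def)
  have cond: "AE \<omega> in M. real_cond_exp M (F i) (X (Suc i)) \<omega> = X i \<omega>" if "i < n" for i
    using assms(3) that by (simp add: martingale_wrt_def F_def)
  \<comment> \<open>\<open>F 0\<close> is generated by the empty prefix, so \<open>X 0\<close> takes
    only one value.\<close>
  have X0: "X 0 \<omega> = c" if "\<omega> \<in> space M" for \<omega>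
    unfolding c_def using \<omega>\<^sub>0 that adapted[of 0, unfolded F_def]
    by (intro measurable_gen_sigma_same_prefix[OF E, of 0]) (auto simp: same_prefix_def)
  \<comment> \<open>The assumed range covers the times from \<open>1\<close> on; the constant
    starting value inherits the bounds as the mean of \<open>X 1\<close>.\<close>
  have c: "c \<in> {0..1}"
  proof -
    interpret F: finite_measure_subalgebra M "F 0"
      unfolding F_def by unfold_locales (rule subalgebra_gen_sigma[OF E], simp)
    have "expectation (X 1) = (\<integral>\<omega>. real_cond_exp M (F 0) (X 1) \<omega> \<partial>M)"
      by (rule F.real_cond_exp_int(2)[OF int[OF assms(2)], symmetric])
    also have "\<dots> = (\<integral>\<omega>. c \<partial>M)"
    proof (rule integral_cong_AE)
      show "AE \<omega> in M. real_cond_exp M (F 0) (X 1) \<omega> = c"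
        using cond[of 0] assms(2) X0 by auto
    qed auto
    finally have "expectation (X 1) = c" by (simp add: prob_space)
    moreover have "0 \<le> expectation (X 1)" "expectation (X 1) \<le> 1"
    proof -
      have X1: "X 1 \<omega> \<in> {0..1}" if "\<omega> \<in> space M" for \<omega>
        by (rule assms(4)) (use assms(2) that in auto)
      show "0 \<le> expectation (X 1)"
        using X1 by (intro Bochner_Integration.integral_nonneg) auto
      show "expectation (X 1) \<le> 1"
        using X1 by (intro integral_le_const int assms(2) AE_I2) auto
    qed
    ultimately show ?thesis by simp
  qed
  have range: "X i \<omega> \<in> {0..1}" if "i \<le> n" "\<omega> \<in> space M" for i \<omega>
  proof (cases "i = 0")
    case True
    then show ?thesis using X0[OF that(2)] c by simp
  next
    case False
    then show ?thesis using that by (intro assms(4)) auto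
  qed
  interpret unit_martingale M F X n
  proof unfold_locales
    show "subalgebra M (F i)" if "i \<le> n" for i
      unfolding F_def by (rule subalgebra_gen_sigma[OF E that])
    show "sets (F i) \<subseteq> sets (F j)" if "i \<le> j" "j \<le> n" for i j
      unfolding F_def by (rule sets_gen_sigma_mono[OF E that])
  qed (fact adapted cond range assms(5))+
  obtain D where D: "good_choice D" using exists_good_choice_family by blast
  define \<tau> where "\<tau> = first_hit (stop_set D) 0 n"
  \<comment> \<open>The integrated bound is used at time \<open>0\<close> on the full event, where
    its left side integrates a constant over a probability space.\<close>
  have "C' n c = (\<integral>\<omega>. indicator (space M) \<omega> * C' (n - 0) (X 0 \<omega>) \<partial>M)"
    by (subst Bochner_Integration.integral_cong[OF refl, of M _ "\<lambda>_. C' n c"])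
      (auto simp: X0 prob_space)
  also have "\<dots> \<le> (\<integral>\<omega>. indicator (space M) \<omega> * jump_at X (first_hit (stop_set D) 0 (n - 0)) \<omega> \<partial>M)"
    using assms(2) sets.top[of "F 0"] space_F[of 0] by (intro C'_le_integral_jump[OF D]) auto
  also have "\<dots> = expectation (jump_at X \<tau>)"
    by (intro Bochner_Integration.integral_cong) (auto simp: \<tau>_def)
  also have "\<dots> \<le> (SUP \<tau>\<in>{\<tau>. specialized M N E n X \<tau>}. expectation (jump_at X \<tau>))"
  proof (rule cSUP_upper)
    show "\<tau> \<in> {\<tau>. specialized M N E n X \<tau>}"
      unfolding \<tau>_def using specialized_first_hit[OF _ E D] by (simp add: F_def)
    \<comment> \<open>A supremum of reals bounds its members only if the set is bounded above; every
      jump is at most \<open>1\<close>.\<close>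
    show "bdd_above ((\<lambda>\<tau>. expectation (jump_at X \<tau>)) ` {\<tau>. specialized M N E n X \<tau>})"
      using range by (intro bdd_aboveI2[where M = 1] jump_at_expectation_le_1[of _ n])
        (auto simp: specialized_def simp del: atLeastAtMost_iff)
  qed
  finally show "C' n (X 0 \<omega>\<^sub>0) \<le> (SUP \<tau>\<in>{\<tau>. specialized M N E n X \<tau>}. expectation (jump_at X \<tau>))"
    by (simp add: c_def)
qed

end
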